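(* Let $n$ be a positive integer, let $C_n^+$ be a strongly oriented cycle on a vertex set $V$ of size $n$, let $C_n^-$ be its reverse on the same vertex set, and let $\Gamma=\{C_n^+,C_n^-\}$. Let $G=G_1+G_2+\cdots+G_l$ be a simple graph where each $G_i=(T_1^i(w_1^i),T_2^i(w_2^i),\dots,T_{m_i}^i(w_{m_i}^i))$ with each $T_j^i$ a tree. Let $D=D_1+\cdots+D_l$ be an oriented graph obtained from $G$ by choosing a strong orientation of each of its cycles (and any orientation of the remaining edges), with $\mathrm{und}(D_i)=G_i$. Let $h:E(D)\to\{C_n^+,C_n^-\}$ be any function such that, for each $i$, $h$ assigns $C_n^-$ to exactly $r_i$ arcs of the cycle of $D_i$. Then $$\mathrm{und}(D\otimes_h\Gamma)\cong \frac{n}{k_1}\big(T_1^1(w_1^1),\dots,T_{m_1}^1(w_{m_1}^1)\big)^{k_1}+\cdots+\frac{n}{k_l}\big(T_1^l(w_1^l),\dots,T_{m_l}^l(w_{m_l}^l)\big)^{k_l},$$ where, for each $i$, $k_i$ is the order of the subgroup of $\mathbb{Z}_n$ generated by $m_i-2r_i$.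
   Context: Notation: for trees $T_1,\dots,T_m$ (each of order $\ge1$) and vertices $w_j\in V(T_j)$, $(T_1(w_1),\dots,T_m(w_m))$ denotes the unicyclic graph obtained from a cycle with vertices $a_1,\dots,a_m$ (edges $a_ja_{j+1}$ and $a_ma_1$) and disjoint copies of $T_1,\dots,T_m$ by identifying $w_j$ with $a_j$. For $k\ge1$, $(T_1(w_1),\dots,T_m(w_m))^k$ denotes $(T_1(w_1),\dots,T_m(w_m),T_1(w_1),\dots,T_m(w_m),\dots,T_1(w_1),\dots,T_m(w_m))$ with the block of $m$ entries repeated $k$ times (a unicyclic graph with a cycle of length $mk$). $+$ is disjoint union and $tH$ is $t$ disjoint copies of $H$. $\mathrm{und}$ denotes underlying graph. Product: for a digraph $D$, a family $\Gamma$ of digraphs with common vertex set $V$ and $h:E(D)\to\Gamma$, $D\otimes_h\Gamma$ has vertex set $V(D)\times V$ and $((a,x),(b,y))$ is an arc iff $(a,b)\in E(D)$ and $(x,y)\in E(h(a,b))$. *)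

theory Defs
  imports
    "Graph_Theory.Digraph_Component"
    "Graph_Theory.Digraph_Isomorphism"
    "HOL-Algebra.Elementary_Groups"
begin

text \<open>
  Digraphs are pair digraphs (no parallel arcs, loops allowed); a simple graph is a finite
  symmetric loop-free pair digraph (locale \<^locale>\<open>pair_graph\<close>), each edge being represented by
  its two arcs. Isomorphism is \<^const>\<open>digraph_iso\<close>.
\<close>

abbreviation und :: "'a pair_pre_digraph \<Rightarrow> 'a pair_pre_digraph" where
  "und D \<equiv> mk_symmetric (with_proj D)"

definition reverse_digraph :: "'a pair_pre_digraph \<Rightarrow> 'a pair_pre_digraph" where
  "reverse_digraph D = \<lparr> pverts = pverts D, parcs = (parcs D)\<inverse> \<rparr>"

definition oriented_graph :: "'a pair_pre_digraph \<Rightarrow> bool" where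
  "oriented_graph D \<longleftrightarrow> pair_digraph D \<and> (\<forall>u v. (u, v) \<in> parcs D \<longrightarrow> (v, u) \<notin> parcs D)"

text \<open>
  The vertex set must consist of the vertices of the directed cycle \<open>p\<close>, so there are as many
  vertices as arcs. On one vertex this is a loop, on two vertices a pair of opposite arcs.
\<close>
definition strongly_oriented_cycle :: "'a pair_pre_digraph \<Rightarrow> bool" where
  "strongly_oriented_cycle C \<longleftrightarrow>
    (\<exists>p. pre_digraph.cycle (with_proj C) p \<and> parcs C = set p \<and> pverts C = fst ` set p)"

text \<open>
  In a symmetric digraph, \<^const>\<open>pre_digraph.cycle\<close> also holds of the closed walks that go back
  and forth along one edge. These are not cycles of the graph, whence the length bound; the
  library's \<^const>\<open>tree\<close> and \<^const>\<open>forest\<close> are unsuitable for graphs for the same reason.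
\<close>
definition graph_cycle :: "'a pair_pre_digraph \<Rightarrow> ('a \<times> 'a) list \<Rightarrow> bool" where
  "graph_cycle G p \<longleftrightarrow> pre_digraph.cycle (with_proj G) p \<and> 3 \<le> length p"

definition graph_tree :: "'a pair_pre_digraph \<Rightarrow> bool" where
  "graph_tree T \<longleftrightarrow>
    pair_graph T \<and> Digraph_Component.connected (with_proj T) \<and> (\<nexists>p. graph_cycle T p)"

text \<open>
  The part of \<open>D\<close> lying on cycles of its underlying graph. If \<open>und D\<close> is unicyclic, this is the
  cycle of \<open>D\<close>, with the orientation inherited from \<open>D\<close>.
\<close>
definition cycle_part :: "'a pair_pre_digraph \<Rightarrow> 'a pair_pre_digraph" where
  "cycle_part D =
    (let A = {e \<in> parcs D. \<exists>p. graph_cycle (und D) p \<and> e \<in> set p}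
     in \<lparr> pverts = fst ` A \<union> snd ` A, parcs = A \<rparr>)"

definition disjoint_sum ::
  "'i set \<Rightarrow> ('i \<Rightarrow> 'a pair_pre_digraph) \<Rightarrow> ('i \<times> 'a) pair_pre_digraph" where
  "disjoint_sum I G =
    \<lparr> pverts = (SIGMA i:I. pverts (G i)),
      parcs = {((i, u), (i, v)) | i u v. i \<in> I \<and> (u, v) \<in> parcs (G i)} \<rparr>"

definition copies :: "nat \<Rightarrow> 'a pair_pre_digraph \<Rightarrow> (nat \<times> 'a) pair_pre_digraph" where
  "copies t H = disjoint_sum {..<t} (\<lambda>_. H)"

text \<open>
  The graph \<open>(T\<^sub>1(w\<^sub>1), \<dots>, T\<^sub>m(w\<^sub>m))\<close> for a list of pairs \<open>(T\<^sub>j, w\<^sub>j)\<close>, indexed from 0. The cycle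
  vertex \<open>a\<^sub>j\<close>, being identified with \<open>w\<^sub>j\<close>, is the copy of \<open>w\<^sub>j\<close> in the \<open>j\<close>th summand. Meaningful
  only for \<open>m \<ge> 3\<close>: there is no cycle of length 1 or 2 in a simple graph.
\<close>
definition unicyclic :: "('t pair_pre_digraph \<times> 't) list \<Rightarrow> (nat \<times> 't) pair_pre_digraph" where
  "unicyclic ts =
    (let m = length ts;
         S = disjoint_sum {..<m} (\<lambda>j. fst (ts ! j));
         a = (\<lambda>j. (j, snd (ts ! j)))
     in \<lparr> pverts = pverts S,
          parcs = parcs S \<union>
            (\<Union>j<m. {(a j, a (Suc j mod m)), (a (Suc j mod m), a j)}) \<rparr>)"

definition list_power :: "'x list \<Rightarrow> nat \<Rightarrow> 'x list" where
  "list_power xs k = concat (replicate k xs)"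

text \<open>
  \<open>D \<otimes>\<^sub>h \<Gamma>\<close>, where \<open>V\<close> is the common vertex set of the digraphs in \<open>\<Gamma>\<close> and \<open>h\<close> maps the arcs of
  \<open>D\<close> into \<open>\<Gamma>\<close>.
\<close>
definition digraph_product ::
  "'a pair_pre_digraph \<Rightarrow> 'v set \<Rightarrow> ('a \<times> 'a \<Rightarrow> 'v pair_pre_digraph)
    \<Rightarrow> ('a \<times> 'v) pair_pre_digraph" where
  "digraph_product D V h =
    \<lparr> pverts = pverts D \<times> V,
      parcs = {((a, x), (b, y)) | a x b y. (a, b) \<in> parcs D \<and> (x, y) \<in> parcs (h (a, b))} \<rparr>"

end

theory Submission
  imports Defs "HOL-Algebra.Multiplicative_Group" "HOL-Number_Theory.Cong"
begin

text \<open>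
  Label \<open>V\<close> by the integers modulo \<open>n\<close> along \<open>C\<close>. An arc of \<open>D\<close> then shifts the second coordinate of
  the product by \<open>1\<close> or \<open>-1\<close>, so the underlying graph of the product is the derived graph of a
  voltage assignment on \<open>und D\<close>. Voltages on trees are coboundaries and can be gauged away; what
  remains of a component is the total voltage \<open>s\<close> of its cycle, which is \<open>m - 2r\<close> up to sign because
  the cycle is strongly oriented. Going around the cycle adds \<open>s\<close>, so the fibre over a vertex splits
  into \<open>n div k\<close> cosets of the subgroup generated by \<open>s\<close>, each giving a cycle that wraps \<open>k\<close> times
  around the original one. The cycle of \<open>D\<close> is recognised inside \<open>und D\<close> as the set of arcs that are
  not bridges, a notion preserved by isomorphisms.
\<close>

section \<open>Isomorphisms by vertex maps\<close>

text \<open>The library's isomorphisms carry separate maps for arcs, heads and tails. For pair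
  digraphs the vertex map determines these, so a vertex bijection that preserves and reflects arcs
  is enough.\<close>

definition pair_iso :: "('a \<Rightarrow> 'b) \<Rightarrow> 'a pair_pre_digraph \<Rightarrow> 'b pair_pre_digraph \<Rightarrow> bool" where
  "pair_iso f G H \<longleftrightarrow> bij_betw f (pverts G) (pverts H) \<and>
    (\<forall>u\<in>pverts G. \<forall>v\<in>pverts G. (u, v) \<in> parcs G \<longleftrightarrow> (f u, f v) \<in> parcs H)"

lemma pair_isoI:
  assumes "bij_betw f (pverts G) (pverts H)"
    and "\<And>u v. u \<in> pverts G \<Longrightarrow> v \<in> pverts G \<Longrightarrow> (u, v) \<in> parcs G \<longleftrightarrow> (f u, f v) \<in> parcs H"
  shows "pair_iso f G H"
  using assms unfolding pair_iso_def by blast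

lemma pair_iso_bij: "pair_iso f G H \<Longrightarrow> bij_betw f (pverts G) (pverts H)"
  by (simp add: pair_iso_def)

lemma pair_iso_arc_iff:
  "pair_iso f G H \<Longrightarrow> u \<in> pverts G \<Longrightarrow> v \<in> pverts G \<Longrightarrow>
    (f u, f v) \<in> parcs H \<longleftrightarrow> (u, v) \<in> parcs G"
  by (simp add: pair_iso_def)

lemma pair_iso_in_verts: "pair_iso f G H \<Longrightarrow> u \<in> pverts G \<Longrightarrow> f u \<in> pverts H"
  by (auto simp: pair_iso_def bij_betw_def)

lemma pair_iso_comp:
  assumes "pair_iso f G H" "pair_iso g H K"
  shows "pair_iso (g \<circ> f) G K"
  using assms pair_iso_in_verts[OF assms(1)]
  unfolding pair_iso_def by (auto intro: bij_betw_trans)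

lemma pair_iso_inv:
  assumes "pair_iso f G H"
  shows "pair_iso (the_inv_into (pverts G) f) H G"
proof (rule pair_isoI)
  let ?g = "the_inv_into (pverts G) f"
  have b: "bij_betw f (pverts G) (pverts H)" using assms by (rule pair_iso_bij)
  show g: "bij_betw ?g (pverts H) (pverts G)"
    using b by (rule bij_betw_the_inv_into)
  have fg: "f (?g u) = u" "?g u \<in> pverts G" if "u \<in> pverts H" for u
    using b g that by (auto simp: bij_betw_def f_the_inv_into_f)
  show "(u, v) \<in> parcs H \<longleftrightarrow> (?g u, ?g v) \<in> parcs G"
    if "u \<in> pverts H" "v \<in> pverts H" for u v
    using pair_iso_arc_iff[OF assms, of "?g u" "?g v"] that by (simp add: fg)
qed

text \<open>The arc map is \<open>map_prod f f\<close>. Since \<open>pair_iso\<close> constrains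
  only pairs of vertices, the arcs of both graphs are required to have their ends among the
  vertices.\<close>

lemma pair_iso_imp_digraph_iso:
  assumes f: "pair_iso f G H"
    and G: "parcs G \<subseteq> pverts G \<times> pverts G" and H: "parcs H \<subseteq> pverts H \<times> pverts H"
  shows "digraph_iso (with_proj G) (with_proj H)"
proof -
  let ?F = "\<lparr>iso_verts = f, iso_arcs = map_prod f f, iso_head = snd, iso_tail = fst\<rparr>"
  have inj: "inj_on f (pverts G)" and img: "f ` pverts G = pverts H"
    using pair_iso_bij[OF f] by (auto simp: bij_betw_def)
  have arcs: "map_prod f f ` parcs G = parcs H"
  proof
    show "map_prod f f ` parcs G \<subseteq> parcs H"
      using G pair_iso_arc_iff[OF f] by fastforce
    show "parcs H \<subseteq> map_prod f f ` parcs G"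
    proof
      fix e assume e: "e \<in> parcs H"
      then have "e \<in> f ` pverts G \<times> f ` pverts G" using H img by auto
      then obtain u v where uv: "u \<in> pverts G" "v \<in> pverts G" "e = (f u, f v)"
        by blast
      then have "(u, v) \<in> parcs G" using e pair_iso_arc_iff[OF f] by auto
      then show "e \<in> map_prod f f ` parcs G" using uv by force
    qed
  qed
  have "wf_digraph (with_proj G)"
    using G by unfold_locales auto
  moreover have "inj_on (map_prod f f) (parcs G)"
    using map_prod_inj_on[OF inj inj] G by (rule inj_on_subset)
  ultimately have "pre_digraph.digraph_isomorphism (with_proj G) ?F"
    using inj by (auto simp: pre_digraph.digraph_isomorphism_def)
  moreover have "with_proj H = app_iso ?F (with_proj G)"
    using img arcs by (simp add: app_iso_def with_proj_def)
  ultimately show ?thesis unfolding digraph_iso_def by blast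
qed

text \<open>Heads and tails in \<open>with_proj H\<close> are the projections, which forces the arc
  map of the isomorphism to be the vertex map applied to both ends.\<close>

lemma digraph_iso_imp_pair_iso:
  assumes "digraph_iso (with_proj G) (with_proj H)"
  obtains f where "pair_iso f G H"
proof -
  obtain F where F: "pre_digraph.digraph_isomorphism (with_proj G) F"
    and H: "with_proj H = app_iso F (with_proj G)"
    using assms by (auto simp: digraph_iso_def)
  let ?f = "iso_verts F"
  have inj: "inj_on ?f (pverts G)" and wf: "wf_digraph (with_proj G)"
    and ends: "\<And>e. e \<in> parcs G \<Longrightarrow>
      ?f (fst e) = iso_tail F (iso_arcs F e) \<and> ?f (snd e) = iso_head F (iso_arcs F e)"
    using F by (auto simp: pre_digraph.digraph_isomorphism_def)
  have HV: "pverts H = ?f ` pverts G" and HA: "parcs H = iso_arcs F ` parcs G"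
    and tl: "iso_tail F = fst" and hd: "iso_head F = snd"
    using H by (auto simp: app_iso_def with_proj_def)
  have arcF: "iso_arcs F e = (?f (fst e), ?f (snd e))" if "e \<in> parcs G" for e
    using ends[OF that] by (simp add: tl hd prod_eq_iff)
  have wf': "(u, v) \<in> parcs G \<Longrightarrow> u \<in> pverts G \<and> v \<in> pverts G" for u v
    using wf_digraph.tail_in_verts[OF wf] wf_digraph.head_in_verts[OF wf] by fastforce
  have "pair_iso ?f G H"
  proof (rule pair_isoI)
    show "bij_betw ?f (pverts G) (pverts H)" using inj HV by (simp add: bij_betw_def)
    show "(u, v) \<in> parcs G \<longleftrightarrow> (?f u, ?f v) \<in> parcs H"
      if "u \<in> pverts G" "v \<in> pverts G" for u v
    proof
      show "(u, v) \<in> parcs G \<Longrightarrow> (?f u, ?f v) \<in> parcs H"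
        using arcF HA by force
      assume "(?f u, ?f v) \<in> parcs H"
      then obtain x y where "(x, y) \<in> parcs G" "?f u = ?f x" "?f v = ?f y"
        using arcF HA by auto
      then show "(u, v) \<in> parcs G" using inj that wf' by (metis inj_onD)
    qed
  qed
  then show thesis by (rule that)
qed

lemma parcs_und: "parcs (und D) = parcs D \<union> (parcs D)\<inverse>"
  by (auto simp: parcs_mk_symmetric)

section \<open>Bridges and cycles\<close>

text \<open>Single steps are mapped into \<open>S\<^sup>*\<close> rather than \<open>S\<close>, so
  that retractions, which collapse some arcs to a point, are covered.\<close>

lemma rtrancl_map:
  assumes "(x, y) \<in> R\<^sup>*" and "\<And>x y. (x, y) \<in> R \<Longrightarrow> (f x, f y) \<in> S\<^sup>*"
  shows "(f x, f y) \<in> S\<^sup>*"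
  using assms(1) by induction (auto intro: rtrancl_trans assms(2))

text \<open>Holds if \<open>{u, v}\<close> is a bridge of the graph \<open>E\<close>; it does not require \<open>(u, v) \<in> E\<close>.\<close>
definition bridge :: "('a \<times> 'a) set \<Rightarrow> 'a \<Rightarrow> 'a \<Rightarrow> bool" where
  "bridge E u v \<longleftrightarrow> (v, u) \<notin> (E - {(u, v), (v, u)})\<^sup>*"

text \<open>The rest of the cycle joins the ends of the edge without using it.\<close>

lemma cycle_not_bridge:
  fixes f :: "nat \<Rightarrow> 'a"
  assumes n: "3 \<le> n" and inj: "inj_on f {..<n}"
    and arcs: "\<And>i. i < n \<Longrightarrow> (f i, f (Suc i mod n)) \<in> E" and i: "i < n"
  shows "\<not> bridge E (f i) (f (Suc i mod n))"
proof -
  let ?E = "E - {(f i, f (Suc i mod n)), (f (Suc i mod n), f i)}"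
  \<comment> \<open>Walk onward from the head of the chosen arc; after n - 1 steps the index is i +
    n, that is, i again.\<close>
  have "(f (Suc i mod n), f ((i + Suc k) mod n)) \<in> ?E\<^sup>*" if "k < n" for k
    using that
  proof (induction k)
    case (Suc k)
    let ?a = "(i + Suc k) mod n" and ?b = "(i + Suc (Suc k)) mod n"
    have b: "?b = Suc ?a mod n" by (simp add: mod_Suc_eq)
    have lt: "?a < n" "?b < n" "Suc i mod n < n" using n by auto
    have ne: "?a \<noteq> i"
      using i Suc.prems by (auto simp: mod_if le_mod_geq split: if_splits)
    \<comment> \<open>Traversing the deleted edge backwards would force i + 2 = i modulo n, which is
      impossible for n at least 3.\<close>
    have ne2: "\<not> (?a = Suc i mod n \<and> ?b = i)"
    proof
      assume "?a = Suc i mod n \<and> ?b = i"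
      then have "Suc (Suc i mod n) mod n = i" using b by simp
      then have "Suc (Suc i) mod n = i" by (simp add: mod_Suc_eq)
      then show False using i n by (auto simp: mod_if le_mod_geq split: if_splits)
    qed
    have feq: "f x = f y \<longleftrightarrow> x = y" if "x < n" "y < n" for x y
      using inj that by (auto dest: inj_onD)
    have "(f ?a, f ?b) \<in> E" using arcs[OF lt(1)] b by simp
    moreover have "f ?a \<noteq> f i" using ne feq lt(1) i by blast
    moreover have "(f ?a, f ?b) \<noteq> (f (Suc i mod n), f i)" using ne2 feq lt i by blast
    ultimately have "(f ?a, f ?b) \<in> ?E" by blast
    then show ?case using Suc by (meson Suc_lessD rtrancl.rtrancl_into_rtrancl)
  qed simp
  from this[of "n - 1"] show ?thesis using n i by (simp add: bridge_def)
qed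

text \<open>\<open>f i\<close> is the tail of the i-th arc. The library asserts that the heads are
  distinct; injectivity of \<open>f\<close> follows because each tail is the head of the cyclically
  preceding arc.\<close>

lemma cycle_nthE:
  assumes "pre_digraph.cycle (with_proj G) p"
  obtains f where "p \<noteq> []" "inj_on f {..<length p}" "set p \<subseteq> parcs G"
    "\<And>i. i < length p \<Longrightarrow> p ! i = (f i, f (Suc i mod length p))"
proof -
  obtain u where cas: "pcas u p u" and dist: "distinct (tl (pawalk_verts u p))"
    and ne: "p \<noteq> []" and sub: "set p \<subseteq> parcs G"
    using assms by (auto simp: pre_digraph.cycle_def pre_digraph.awalk_def
        cas_with_proj_eq awalk_verts_with_proj_eq)
  have step: "snd (p ! i) = (if Suc i < length p then fst (p ! Suc i) else v)"
    if "pcas w p v" "i < length p" for w v i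
    using that
  proof (induction p arbitrary: w i)
    case (Cons e p)
    then show ?case by (cases i; cases p) auto
  qed simp
  have hd: "fst (p ! 0) = u" using cas ne by (cases p) auto
  have "pawalk_verts w p = w # map snd p" if "pcas w p v" for w v
    using that by (induction p arbitrary: w) auto
  with cas dist have "distinct (map snd p)" by simp
  then have dsnd: "inj_on (\<lambda>i. snd (p ! i)) {..<length p}"
    by (auto simp: distinct_conv_nth inj_on_def)
  let ?f = "\<lambda>i. fst (p ! i)"
  have p_nth: "p ! i = (?f i, ?f (Suc i mod length p))" if "i < length p" for i
    using step[OF cas that] hd that
    by (cases "Suc i < length p") (auto simp: prod_eq_iff dest: Suc_lessI)
  have "inj_on ?f {..<length p}"
  proof (rule inj_onI)
    let ?n = "length p"
    have pr: "?f i = snd (p ! ((i + ?n - 1) mod ?n))" if "i < ?n" for i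
    proof -
      have "(i + ?n - 1) mod ?n < ?n" using ne by simp
      moreover have "Suc ((i + ?n - 1) mod ?n) mod ?n = i"
        using that ne by (simp add: mod_Suc_eq)
      ultimately show ?thesis using p_nth by (metis snd_conv)
    qed
    fix i j assume ij: "i \<in> {..<?n}" "j \<in> {..<?n}" "?f i = ?f j"
    then have "snd (p ! ((i + ?n - 1) mod ?n)) = snd (p ! ((j + ?n - 1) mod ?n))"
      using pr by simp
    then have "(i + ?n - 1) mod ?n = (j + ?n - 1) mod ?n"
      using dsnd ne by (auto dest!: inj_onD)
    then have "Suc ((i + ?n - 1) mod ?n) mod ?n = Suc ((j + ?n - 1) mod ?n) mod ?n" by simp
    then show "i = j" using ij ne by (simp add: mod_Suc_eq)
  qed
  then show thesis using that ne sub p_nth by blast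
qed

lemma not_bridge_if_graph_cycle:
  assumes "graph_cycle G p" "(u, v) \<in> set p"
  shows "\<not> bridge (parcs G) u v"
proof -
  have len: "3 \<le> length p" and "pre_digraph.cycle (with_proj G) p"
    using assms(1) by (auto simp: graph_cycle_def)
  then obtain f where f: "inj_on f {..<length p}" "set p \<subseteq> parcs G"
    "\<And>i. i < length p \<Longrightarrow> p ! i = (f i, f (Suc i mod length p))"
    by (auto elim: cycle_nthE)
  obtain i where "i < length p" "p ! i = (u, v)"
    using assms(2) by (auto simp: in_set_conv_nth)
  moreover have "(f j, f (Suc j mod length p)) \<in> parcs G" if "j < length p" for j
    using f(2,3) that by (metis nth_mem subsetD)
  ultimately show ?thesis
    using cycle_not_bridge[OF len f(1)] f(3) by (metis prod.inject)
qed

text \<open>There is a path from v to u in the graph without the edge, and prefixing (u, v) closes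
  it to a cycle.\<close>

lemma graph_cycle_if_not_bridge:
  assumes G: "parcs G \<subseteq> pverts G \<times> pverts G" and arc: "(u, v) \<in> parcs G" "u \<noteq> v"
    and nb: "\<not> bridge (parcs G) u v"
  obtains p where "graph_cycle G p" "(u, v) \<in> set p"
proof -
  let ?H = "\<lparr>pverts = pverts G, parcs = parcs G - {(u, v), (v, u)}\<rparr>"
  interpret H: pair_wf_digraph ?H
    using G by unfold_locales auto
  have "(x, y) \<in> (parcs ?H)\<^sup>* \<Longrightarrow> x \<in> pverts ?H \<Longrightarrow> x \<rightarrow>\<^sup>*\<^bsub>with_proj ?H\<^esub> y" for x y
  proof (induction rule: rtrancl_induct)
    case (step y z)
    then show ?case using H.reachable_adj_trans by simp
  qed simp
  then have "v \<rightarrow>\<^sup>*\<^bsub>with_proj ?H\<^esub> u"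
    using nb arc G by (auto simp: bridge_def)
  then obtain q where q: "H.apath v q u" using H.reachable_apath by blast
  then have qp: "set q \<subseteq> parcs ?H" "pcas v q u" "distinct (pawalk_verts v q)"
    by (auto simp: H.apath_def H.awalk_def)
  \<comment> \<open>An empty path would make u = v, and a path of one arc would be the deleted (v,
    u); hence the closed walk has length at least 3.\<close>
  have "2 \<le> length q"
    using qp(1,2) arc(2) by (cases q rule: remdups_adj.cases) auto
  then have "graph_cycle G ((u, v) # q)"
    using qp arc G unfolding graph_cycle_def pre_digraph.cycle_def pre_digraph.awalk_def
    by (auto simp: cas_with_proj_eq awalk_verts_with_proj_eq)
  then show thesis using that by simp
qed

text \<open>Without one edge a potential exists by induction; as the edge is a bridge, one side of
  it can be shifted to meet the remaining equation. Describing forests by bridges makes the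
  condition pass to subgraphs.\<close>

lemma forest_potential:
  fixes \<epsilon> :: "'a \<Rightarrow> 'a \<Rightarrow> int"
  assumes "finite E" "sym E"
    and "\<And>u v. (u, v) \<in> E \<Longrightarrow> bridge E u v"
    and "\<And>u v. (u, v) \<in> E \<Longrightarrow> \<epsilon> v u = - \<epsilon> u v"
  shows "\<exists>\<phi>. \<forall>(u, v)\<in>E. \<phi> v = \<phi> u + \<epsilon> u v"
  using assms
proof (induction E rule: finite_psubset_induct)
  case (psubset E)
  show ?case
  proof (cases "E = {}")
    case False
    then obtain u v where uv: "(u, v) \<in> E" by auto
    let ?F = "E - {(u, v), (v, u)}"
    have symF: "sym ?F" using psubset.prems(1) by (auto simp: sym_def)
    have mono: "bridge E x y \<Longrightarrow> bridge ?F x y" for x y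
      unfolding bridge_def by (meson Diff_mono Diff_subset order_refl rtrancl_mono subsetD)
    have "\<exists>\<phi>. \<forall>(x, y)\<in>?F. \<phi> y = \<phi> x + \<epsilon> x y"
      by (rule psubset.IH) (use uv symF mono psubset.prems in auto)
    then obtain \<phi> where \<phi>: "\<And>x y. (x, y) \<in> ?F \<Longrightarrow> \<phi> y = \<phi> x + \<epsilon> x y" by blast
    have br: "(v, u) \<notin> ?F\<^sup>*" using psubset.prems(2)[OF uv] by (simp add: bridge_def)
    text \<open>Shift the potential on the component of \<open>v\<close> in the graph without the bridge \<open>{u, v}\<close>.\<close>
    let ?\<psi> = "\<lambda>x. \<phi> x + (if (v, x) \<in> ?F\<^sup>* then \<phi> u + \<epsilon> u v - \<phi> v else 0)"
    have "?\<psi> y = ?\<psi> x + \<epsilon> x y" if "(x, y) \<in> E" for x y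
    proof (cases "(x, y) \<in> ?F")
      case True
      then have "(y, x) \<in> ?F" using symF by (auto simp: sym_def)
      then have "(v, x) \<in> ?F\<^sup>* \<longleftrightarrow> (v, y) \<in> ?F\<^sup>*"
        using True by (meson rtrancl.rtrancl_into_rtrancl)
      then show ?thesis using \<phi>[OF True] by simp
    next
      case False
      then have "x = u \<and> y = v \<or> x = v \<and> y = u" using that by auto
      then show ?thesis using br psubset.prems(3)[OF uv] by auto
    qed
    then have "\<forall>(x, y)\<in>E. ?\<psi> y = ?\<psi> x + \<epsilon> x y" by blast
    then show ?thesis by (rule exI[where x = ?\<psi>])
  qed simp
qed

section \<open>Cyclic subgroups of the integers modulo \<open>n\<close>\<close>

text \<open>After division by the gcd, n and s become coprime, so the factor coming from s can be
  cancelled.\<close>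

lemma dvd_mult_iff_div_gcd_dvd:
  fixes n s t :: int
  assumes "n \<noteq> 0"
  shows "n dvd t * s \<longleftrightarrow> n div gcd n s dvd t"
proof -
  let ?g = "gcd n s"
  have g: "?g \<noteq> 0" using assms by simp
  have "n dvd t * s \<longleftrightarrow> ?g * (n div ?g) dvd ?g * (t * (s div ?g))"
    by (simp add: mult.left_commute)
  also have "\<dots> \<longleftrightarrow> n div ?g dvd t * (s div ?g)"
    using g by (simp only: dvd_mult_cancel_left simp_thms)
  also have "\<dots> \<longleftrightarrow> n div ?g dvd t"
    using assms by (intro coprime_dvd_mult_left_iff div_gcd_coprime) simp
  finally show ?thesis .
qed

text \<open>The subgroup is as large as the order of its generator, and that order is recognised by
  its multiples: t * s vanishes modulo n exactly when n / gcd(n, s) divides t.\<close>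

lemma card_generate_integer_mod_group:
  assumes "n \<noteq> 0"
  shows "card (generate (integer_mod_group n) {s mod int n}) = n div nat (gcd (int n) s)"
proof -
  let ?G = "integer_mod_group n" and ?x = "s mod int n"
  interpret group ?G by simp
  have x: "?x \<in> carrier ?G" using assms by (simp add: carrier_integer_mod_group)
  have g: "gcd (int n) s = int (nat (gcd (int n) s))" by simp
  have "ord ?x dvd t \<longleftrightarrow> n div nat (gcd (int n) s) dvd t" for t
  proof -
    have "ord ?x dvd t \<longleftrightarrow> (int t * ?x) mod int n = 0"
      using pow_eq_id[OF x, of t] by simp
    also have "\<dots> \<longleftrightarrow> int n dvd int t * s"
      by (simp add: mod_mult_right_eq mod_eq_0_iff_dvd)
    also have "\<dots> \<longleftrightarrow> int n div gcd (int n) s dvd int t"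
      using assms by (simp add: dvd_mult_iff_div_gcd_dvd)
    also have "\<dots> \<longleftrightarrow> n div nat (gcd (int n) s) dvd t"
      by (subst g) (simp only: flip: zdiv_int, simp)
    finally show ?thesis .
  qed
  then have "ord ?x = n div nat (gcd (int n) s)" by (meson dvd_antisym dvd_refl)
  then show ?thesis using generate_pow_card[OF x] by simp
qed

text \<open>Here c names a coset of the subgroup generated by s, and q a position in it. Modulo g
  the multiples of s vanish, which determines c; after cancelling it, n divides (q - q') * s, so k
  divides q - q'.\<close>

lemma residue_decomposition_inj:
  fixes n k g :: nat and s :: int
  assumes n: "n \<noteq> 0" and g: "g = nat (gcd (int n) s)" and k: "k = n div g"
    and lt: "c < g" "c' < g" "q < k" "q' < k"
    and cong: "[int c + int q * s = int c' + int q' * s] (mod int n)"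
  shows "c = c' \<and> q = q'"
proof -
  have gi: "int g = gcd (int n) s" using g by simp
  have "int g dvd int n" "int g dvd s" by (simp_all add: gi)
  then have "[int c + int q * s = int c' + int q' * s] (mod int g)"
    and "[int q * s = 0] (mod int g)" "[int q' * s = 0] (mod int g)"
    using cong by (auto simp: cong_0_iff intro: cong_dvd_modulus)
  then have "[int c = int c'] (mod int g)"
    by (metis add.right_neutral cong_add_lcancel cong_sym cong_trans)
  then have c: "c = c'" using lt by (simp add: cong_int_iff cong_def)
  then have "[int q * s = int q' * s] (mod int n)"
    using cong by (simp add: cong_add_lcancel)
  then have "int n dvd (int q - int q') * s"
    by (simp add: cong_iff_dvd_diff left_diff_distrib)
  then have "int k dvd int q - int q'"
    using n by (simp add: dvd_mult_iff_div_gcd_dvd k zdiv_int flip: gi)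
  then have "[int q = int q'] (mod int k)" by (simp add: cong_iff_dvd_diff)
  then show ?thesis using c lt by (simp add: cong_int_iff cong_def)
qed

text \<open>By counting: the g * k = n pairs give distinct residues modulo n, hence all of
  them.\<close>

lemma residue_decomposition_surj:
  fixes n k g :: nat and s y :: int
  assumes n: "n \<noteq> 0" and g: "g = nat (gcd (int n) s)" and k: "k = n div g"
  obtains c q where "c < g" "q < k" "[int c + int q * s = y] (mod int n)"
proof -
  let ?f = "\<lambda>(c, q). (int c + int q * s) mod int n"
  have "int g dvd int n" using g by simp
  then have gk: "g * k = n" using k by auto
  have inj: "inj_on ?f ({..<g} \<times> {..<k})"
    using residue_decomposition_inj[OF n g k] by (auto simp: inj_on_def cong_def)
  have "?f ` ({..<g} \<times> {..<k}) \<subseteq> {0..<int n}" using n by auto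
  moreover have "card (?f ` ({..<g} \<times> {..<k})) = card {0..<int n}"
    using gk by (simp add: card_image[OF inj] card_cartesian_product)
  ultimately have "?f ` ({..<g} \<times> {..<k}) = {0..<int n}"
    by (intro card_subset_eq) auto
  moreover have "y mod int n \<in> {0..<int n}" using n by simp
  ultimately have "y mod int n \<in> ?f ` ({..<g} \<times> {..<k})" by simp
  then obtain c q where "c < g" "q < k" "(int c + int q * s) mod int n = y mod int n" by auto
  then show thesis by (intro that) (auto simp: cong_def)
qed

section \<open>Voltage graphs over cycles of trees\<close>

lemma length_list_power [simp]: "length (list_power xs k) = k * length xs"
  by (simp add: list_power_def length_concat sum_list_replicate)

lemma nth_list_power: "t < k * length xs \<Longrightarrow> list_power xs k ! t = xs ! (t mod length xs)"
proof (induction k arbitrary: t)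
  case (Suc k)
  have "list_power xs (Suc k) = xs @ list_power xs k" by (simp add: list_power_def)
  then show ?case
    using Suc by (cases "t < length xs") (auto simp: nth_append le_mod_geq)
qed simp

abbreviation cycle_vertex :: "('t pair_pre_digraph \<times> 't) list \<Rightarrow> nat \<Rightarrow> nat \<times> 't" where
  "cycle_vertex ts j \<equiv> (j, snd (ts ! j))"

lemma in_pverts_disjoint_sum [simp]:
  "(i, u) \<in> pverts (disjoint_sum I G) \<longleftrightarrow> i \<in> I \<and> u \<in> pverts (G i)"
  by (simp add: disjoint_sum_def)

lemma in_parcs_disjoint_sum [simp]:
  "((i, u), (j, v)) \<in> parcs (disjoint_sum I G) \<longleftrightarrow> i = j \<and> i \<in> I \<and> (u, v) \<in> parcs (G i)"
  by (auto simp: disjoint_sum_def)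

lemma in_pverts_unicyclic [simp]:
  "(i, u) \<in> pverts (unicyclic ts) \<longleftrightarrow> i < length ts \<and> u \<in> pverts (fst (ts ! i))"
  by (simp add: unicyclic_def Let_def)

lemma in_parcs_unicyclic:
  "((i, u), (j, v)) \<in> parcs (unicyclic ts) \<longleftrightarrow> i < length ts \<and> j < length ts \<and>
    (i = j \<and> (u, v) \<in> parcs (fst (ts ! i)) \<or>
     u = snd (ts ! i) \<and> v = snd (ts ! j) \<and> (j = Suc i mod length ts \<or> i = Suc j mod length ts))"
  by (cases "ts = []") (auto simp: unicyclic_def Let_def)

text \<open>The derived graph of the voltage assignment \<open>\<epsilon>\<close>, with voltages in the integers modulo \<open>n\<close>.\<close>
definition voltage_graph ::
  "'a pair_pre_digraph \<Rightarrow> nat \<Rightarrow> ('a \<Rightarrow> 'a \<Rightarrow> int) \<Rightarrow> ('a \<times> int) pair_pre_digraph" where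
  "voltage_graph G n \<epsilon> =
    \<lparr> pverts = pverts G \<times> {0..<int n},
      parcs = {((u, x), (v, y)) | u x v y. (u, v) \<in> parcs G \<and> x \<in> {0..<int n} \<and>
        y \<in> {0..<int n} \<and> [y = x + \<epsilon> u v] (mod int n)} \<rparr>"

lemma in_parcs_voltage_graph:
  "((u, x), (v, y)) \<in> parcs (voltage_graph G n \<epsilon>) \<longleftrightarrow> (u, v) \<in> parcs G \<and>
    x \<in> {0..<int n} \<and> y \<in> {0..<int n} \<and> [y = x + \<epsilon> u v] (mod int n)"
  by (simp add: voltage_graph_def)

section \<open>Arcs and bridges of a cycle of trees, and its derived graphs\<close>

locale cycle_of_trees =
  fixes ts :: "('t pair_pre_digraph \<times> 't) list"
  assumes length_ge: "3 \<le> length ts"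
    and graph_trees: "\<And>T w. (T, w) \<in> set ts \<Longrightarrow> graph_tree T \<and> w \<in> pverts T"
begin

abbreviation "m \<equiv> length ts"
abbreviation "T j \<equiv> fst (ts ! j)"
abbreviation "w j \<equiv> snd (ts ! j)"
abbreviation "U \<equiv> unicyclic ts"
abbreviation "a \<equiv> cycle_vertex ts"

lemma m_pos: "0 < m" using length_ge by linarith

lemma tree: "j < m \<Longrightarrow> graph_tree (T j)" and root_in_tree: "j < m \<Longrightarrow> w j \<in> pverts (T j)"
  using graph_trees[of "T j" "w j"] by auto

lemma tree_finite: "j < m \<Longrightarrow> finite (parcs (T j))"
  using tree[of j] by (auto simp: graph_tree_def pair_graph_def pair_digraph_def
      pair_fin_digraph_def pair_fin_digraph_axioms_def)

lemma tree_wf: "j < m \<Longrightarrow> parcs (T j) \<subseteq> pverts (T j) \<times> pverts (T j)"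
  using tree[of j] by (auto simp: graph_tree_def pair_graph_def pair_digraph_def
      pair_fin_digraph_def dest: pair_wf_digraph.in_arcsD1 pair_wf_digraph.in_arcsD2)

lemma tree_sym: "j < m \<Longrightarrow> sym (parcs (T j))"
  using tree[of j] by (auto simp: graph_tree_def pair_graph_def pair_pseudo_graph_def
      pair_sym_digraph_def pair_sym_digraph_axioms_def symmetric_def)

lemma tree_bridge:
  assumes "j < m" "(u, v) \<in> parcs (T j)"
  shows "bridge (parcs (T j)) u v"
proof (rule ccontr)
  assume "\<not> bridge (parcs (T j)) u v"
  moreover have "u \<noteq> v" using tree[OF assms(1)] assms(2)
    by (auto simp: graph_tree_def pair_graph_def pair_digraph_def pair_loopfree_digraph_def
        pair_loopfree_digraph_axioms_def)
  ultimately obtain p where "graph_cycle (T j) p"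
    using graph_cycle_if_not_bridge[OF tree_wf[OF assms(1)] assms(2)] by metis
  then show False using tree[OF assms(1)] by (simp add: graph_tree_def)
qed

lemma unicyclic_wf: "parcs U \<subseteq> pverts U \<times> pverts U"
proof
  fix e assume "e \<in> parcs U"
  moreover obtain i u j v where "e = ((i, u), (j, v))" by (metis surj_pair)
  ultimately show "e \<in> pverts U \<times> pverts U"
    using tree_wf root_in_tree by (auto simp: in_parcs_unicyclic)
qed

lemma unicyclic_sym:
  assumes "(x, y) \<in> parcs U"
  shows "(y, x) \<in> parcs U"
proof -
  obtain i u j v where xy: "x = (i, u)" "y = (j, v)" by (metis surj_pair)
  show ?thesis
    using assms tree_sym[of i] symD[of "parcs (T i)" u v]
    unfolding xy in_parcs_unicyclic by blast
qed

lemma cycle_arc: "j < m \<Longrightarrow> (a j, a (Suc j mod m)) \<in> parcs U"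
  using m_pos by (simp add: in_parcs_unicyclic)

lemma Suc_mod_ne: "j < m \<Longrightarrow> Suc j mod m \<noteq> j"
  using length_ge by (auto simp: mod_Suc)

lemma not_bridge_cycle_arc: "j < m \<Longrightarrow> \<not> bridge (parcs U) (a j) (a (Suc j mod m))"
  using cycle_arc length_ge by (intro cycle_not_bridge) (auto simp: inj_on_def)

lemma bridge_tree_arc:
  assumes j: "j < m" and uv: "(u, v) \<in> parcs (T j)"
  shows "bridge (parcs U) (j, u) (j, v)"
  unfolding bridge_def
proof
  text \<open>Collapsing the rest of the graph to the root retracts it onto the tree.\<close>
  let ?f = "\<lambda>(i, x). if i = j then x else w j"
  let ?S = "parcs (T j) - {(u, v), (v, u)}"
  assume "((j, v), (j, u)) \<in> (parcs U - {((j, u), (j, v)), ((j, v), (j, u))})\<^sup>*"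
  then have "(?f (j, v), ?f (j, u)) \<in> ?S\<^sup>*"
  proof (rule rtrancl_map)
    fix x y assume "(x, y) \<in> parcs U - {((j, u), (j, v)), ((j, v), (j, u))}"
    then show "(?f x, ?f y) \<in> ?S\<^sup>*"
      using Suc_mod_ne[OF j] by (cases x; cases y) (auto simp: in_parcs_unicyclic)
  qed
  then show False using tree_bridge[OF assms] by (simp add: bridge_def)
qed

text \<open>Potentials that vanish at the roots gauge the trees away without changing the voltages
  of the cycle arcs.\<close>

lemma tree_potentials:
  fixes \<epsilon> :: "nat \<times> 't \<Rightarrow> nat \<times> 't \<Rightarrow> int"
  assumes antisym: "\<And>x y. (x, y) \<in> parcs U \<Longrightarrow> \<epsilon> y x = - \<epsilon> x y"
  obtains \<phi> where "\<And>j. \<phi> j (w j) = 0"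
    and "\<And>j u v. j < m \<Longrightarrow> (u, v) \<in> parcs (T j) \<Longrightarrow> \<phi> j v = \<phi> j u + \<epsilon> (j, u) (j, v)"
proof -
  have "\<exists>\<phi>. \<forall>(u, v)\<in>parcs (T j). \<phi> v = \<phi> u + \<epsilon> (j, u) (j, v)" if j: "j < m" for j
    using j by (intro forest_potential)
      (auto simp: tree_finite tree_sym tree_bridge in_parcs_unicyclic intro!: antisym)
  then have "\<forall>j. \<exists>\<phi>. j < m \<longrightarrow> (\<forall>(u, v)\<in>parcs (T j). \<phi> v = \<phi> u + \<epsilon> (j, u) (j, v))"
    by blast
  from choice[OF this] obtain \<psi> where
    "\<forall>j. j < m \<longrightarrow> (\<forall>(u, v)\<in>parcs (T j). \<psi> j v = \<psi> j u + \<epsilon> (j, u) (j, v))"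
    by blast
  then have \<psi>: "\<And>j u v. j < m \<Longrightarrow> (u, v) \<in> parcs (T j) \<Longrightarrow>
      \<psi> j v = \<psi> j u + \<epsilon> (j, u) (j, v)"
    by blast
  show thesis
    by (rule that[of "\<lambda>j v. \<psi> j v - \<psi> j (w j)"]) (simp_all add: \<psi>)
qed

text \<open>The isomorphism lifts the walk that goes k times around the cycle, starting at height c
  over \<open>a 0\<close>. As c < g runs through representatives of the cosets, these lifts and the
  trees attached to them fill every fibre exactly once.\<close>

lemma voltage_graph_iso:
  fixes \<epsilon> :: "nat \<times> 't \<Rightarrow> nat \<times> 't \<Rightarrow> int"
  assumes antisym: "\<And>x y. (x, y) \<in> parcs U \<Longrightarrow> \<epsilon> y x = - \<epsilon> x y"
    and n: "n \<noteq> 0"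
    and s: "s = (\<Sum>j<m. \<epsilon> (a j) (a (Suc j mod m)))"
    and g: "g = nat (gcd (int n) s)" and k: "k = n div g"
  obtains \<Phi> where
    "pair_iso \<Phi> (copies g (unicyclic (list_power ts k))) (voltage_graph U n \<epsilon>)"
proof -
  obtain \<phi> where \<phi>_root: "\<And>j. \<phi> j (w j) = 0"
    and \<phi>: "\<And>j u v. j < m \<Longrightarrow> (u, v) \<in> parcs (T j) \<Longrightarrow> \<phi> j v = \<phi> j u + \<epsilon> (j, u) (j, v)"
    using tree_potentials[of \<epsilon>, OF antisym] by blast
  define \<sigma> where "\<sigma> t = (\<Sum>i<t. \<epsilon> (a (i mod m)) (a (Suc (i mod m) mod m)))" for t
  have \<sigma>_Suc: "\<sigma> (Suc t) = \<sigma> t + \<epsilon> (a (t mod m)) (a (Suc (t mod m) mod m))" for t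
    by (simp add: \<sigma>_def)
  have "\<sigma> m = s" by (simp add: \<sigma>_def s)
  \<comment> \<open>One full turn adds s, so \<open>\<sigma>\<close> is periodic up to multiples of
    s.\<close>
  then have "\<sigma> (m + t) = s + \<sigma> t" for t
    by (induction t) (simp_all add: \<sigma>_Suc, simp add: \<sigma>_def)
  then have "\<sigma> (q * m + t) = int q * s + \<sigma> t" for q t
    by (induction q) (simp_all add: add.assoc distrib_right)
  then have \<sigma>_decomp: "\<sigma> t = int (t div m) * s + \<sigma> (t mod m)" for t
    by (metis div_mult_mod_eq)
  let ?N = "k * m"
  have "int g dvd int n" using g by simp
  then have gk: "g * k = n" using k by auto
  then have k_pos: "0 < k" using n by (auto intro: Nat.gr0I)
  \<comment> \<open>k turns collect k * s, which n divides because k = n / gcd(n, s): the lifted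
    walk closes up after k * m steps.\<close>
  have "\<sigma> ?N = int k * s" using \<sigma>_decomp[of ?N] m_pos by (simp add: \<sigma>_def)
  moreover have "int n dvd int k * s"
    using n g gk by (subst dvd_mult_iff_div_gcd_dvd) (auto simp: k zdiv_int)
  ultimately have \<sigma>_N: "[\<sigma> ?N = 0] (mod int n)" by (simp add: cong_0_iff)
  have Suc_mod: "(Suc t mod ?N) mod m = Suc (t mod m) mod m" for t
    by (simp add: mod_mod_cancel mod_Suc_eq)
  let ?H = "copies g (unicyclic (list_power ts k))" and ?W = "voltage_graph U n \<epsilon>"
  have in_H: "(c, t, v) \<in> pverts ?H \<longleftrightarrow> c < g \<and> t < ?N \<and> v \<in> pverts (T (t mod m))" for c t v
    by (auto simp: copies_def nth_list_power)
  have arc_H: "((c, t, v), (c', t', v')) \<in> parcs ?H \<longleftrightarrow> c = c' \<and> c < g \<and> t < ?N \<and> t' < ?N \<and>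
      (t = t' \<and> (v, v') \<in> parcs (T (t mod m)) \<or>
       v = w (t mod m) \<and> v' = w (t' mod m) \<and> (t' = Suc t mod ?N \<or> t = Suc t' mod ?N))"
    for c t v c' t' v'
    by (auto simp: copies_def nth_list_power in_parcs_unicyclic)
  text \<open>\<open>pot c t v\<close> is the height in the derived graph of the vertex \<open>v\<close> of the \<open>t\<close>th tree in the
    \<open>c\<close>th copy; \<open>\<sigma> t\<close> is the voltage collected on the first \<open>t\<close> steps around the cycle.\<close>
  define pot where "pot c t v = int c + \<sigma> t + \<phi> (t mod m) v" for c t v
  \<comment> \<open>\<open>?lift\<close> is adjacency of the images in the derived graph, with
    heights that are integers not yet reduced modulo n.\<close>
  let ?lift = "\<lambda>c t v c' t' v'. ((t mod m, v), (t' mod m, v')) \<in> parcs U \<and>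
    [pot c' t' v' = pot c t v + \<epsilon> (t mod m, v) (t' mod m, v')] (mod int n)"
  have lift_sym: "?lift c' t' v' c t v" if L: "?lift c t v c' t' v'" for c t v c' t' v'
  proof -
    have U: "((t mod m, v), (t' mod m, v')) \<in> parcs U" using L by simp
    have "[pot c t v + \<epsilon> (t mod m, v) (t' mod m, v') + \<epsilon> (t' mod m, v') (t mod m, v) =
        pot c' t' v' + \<epsilon> (t' mod m, v') (t mod m, v)] (mod int n)"
      using L by (intro cong_add) (auto intro: cong_sym)
    then show ?thesis using antisym[OF U] unicyclic_sym[OF U] by simp
  qed
  have H_sym: "((c', t', v'), (c, t, v)) \<in> parcs ?H"
    if "((c, t, v), (c', t', v')) \<in> parcs ?H" for c t v c' t' v'
    using that tree_sym[of "t mod m"] m_pos by (auto simp: arc_H elim: symE)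
  \<comment> \<open>Over one base vertex the contributions of the partial turn and of the tree agree
    and cancel; what remains is the residue decomposition with q = t div m.\<close>
  have pot_inj: "c = c' \<and> t = t'"
    if "c < g" "c' < g" "t < ?N" "t' < ?N" "t mod m = t' mod m"
      "[pot c t v = pot c' t' v] (mod int n)" for c t c' t' v
  proof -
    have "[(int c + int (t div m) * s) + (\<sigma> (t mod m) + \<phi> (t mod m) v) =
      (int c' + int (t' div m) * s) + (\<sigma> (t mod m) + \<phi> (t mod m) v)] (mod int n)"
      using that(5,6) unfolding pot_def
      by (subst (asm) (1 2) \<sigma>_decomp) (simp add: add.assoc)
    then have "[int c + int (t div m) * s = int c' + int (t' div m) * s] (mod int n)"
      by (simp only: cong_add_rcancel)
    then have "c = c' \<and> t div m = t' div m"
      using that(1-4) by (intro residue_decomposition_inj[OF n g k])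
        (auto simp: less_mult_imp_div_less)
    then show ?thesis using that(5) by (metis div_mult_mod_eq)
  qed
  have tree_lift: "?lift c t v c t v'" if "(v, v') \<in> parcs (T (t mod m))" for c t v v'
    using that \<phi>[OF _ that] m_pos by (simp add: pot_def in_parcs_unicyclic add.assoc)
  have cycle_lift: "?lift c t (w (t mod m)) c (Suc t mod ?N) (w (Suc (t mod m) mod m))"
    if "t < ?N" for c t
  proof -
    \<comment> \<open>Only the last step wraps, from \<open>?N\<close> to 0, and there the heights
      agree modulo n.\<close>
    have "[\<sigma> (Suc t mod ?N) = \<sigma> (Suc t)] (mod int n)"
    proof (cases "Suc t = ?N")
      case True
      have "\<sigma> (Suc t mod ?N) = 0" unfolding True by (simp add: \<sigma>_def)
      then show ?thesis unfolding True using cong_sym[OF \<sigma>_N] by simp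
    next
      case False
      then have "Suc t mod ?N = Suc t" using that by (intro mod_less) linarith
      then show ?thesis by simp
    qed
    then have "[pot c (Suc t mod ?N) (w (Suc (t mod m) mod m)) = int c + \<sigma> (Suc t)] (mod int n)"
      using \<phi>_root by (simp add: pot_def Suc_mod cong_add_lcancel)
    then show ?thesis
      using m_pos cycle_arc[of "t mod m"] \<phi>_root by (simp add: Suc_mod \<sigma>_Suc pot_def add.assoc)
  qed
  have lift_if_arc: "?lift c t v c' t' v'" if "((c, t, v), (c', t', v')) \<in> parcs ?H"
    for c t v c' t' v'
    using that tree_lift cycle_lift[of t] lift_sym[OF cycle_lift[of t']]
    by (auto simp: arc_H Suc_mod)
  \<comment> \<open>Unique lifting: the tail and the base arc fix the height of the head modulo n,
    so by \<open>pot_inj\<close> the head is that of the lifted cycle step.\<close>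
  have cycle_arc_if_lift: "((c, t, v), (c', t', v')) \<in> parcs ?H"
    if L: "?lift c t v c' t' v'" and in_verts: "(c, t, v) \<in> pverts ?H" "(c', t', v') \<in> pverts ?H"
      and v: "v = w (t mod m)" "v' = w (t' mod m)" and t': "t' mod m = Suc (t mod m) mod m"
    for c t v c' t' v'
  proof -
    have "?lift c t v c (Suc t mod ?N) v'"
      using cycle_lift[of t c] in_verts v t' by (simp add: in_H)
    then have "[pot c' t' v' = pot c (Suc t mod ?N) v'] (mod int n)"
      using L t' Suc_mod by (metis cong_sym cong_trans)
    then have "c' = c \<and> t' = Suc t mod ?N"
      using in_verts t' Suc_mod k_pos m_pos by (intro pot_inj) (auto simp: in_H)
    then show ?thesis using in_verts v by (auto simp: in_H arc_H)
  qed
  \<comment> \<open>A base arc inside a tree also lifts uniquely; a backward cycle arc is reversed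
    to a forward one.\<close>
  have arc_if_lift: "((c, t, v), (c', t', v')) \<in> parcs ?H"
    if L: "?lift c t v c' t' v'" and in_verts: "(c, t, v) \<in> pverts ?H" "(c', t', v') \<in> pverts ?H"
    for c t v c' t' v'
  proof -
    have "((t mod m, v), (t' mod m, v')) \<in> parcs U" using L by simp
    then consider (tree) "t mod m = t' mod m" "(v, v') \<in> parcs (T (t mod m))"
      | (forward) "v = w (t mod m)" "v' = w (t' mod m)" "t' mod m = Suc (t mod m) mod m"
      | (backward) "v = w (t mod m)" "v' = w (t' mod m)" "t mod m = Suc (t' mod m) mod m"
      unfolding in_parcs_unicyclic by blast
    then show ?thesis
    proof cases
      case tree
      then have "[pot c' t' v' = pot c t v'] (mod int n)"
        using L tree_lift[of v v' t c] by (metis cong_sym cong_trans)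
      then have "c' = c \<and> t' = t"
        using in_verts tree by (intro pot_inj) (auto simp: in_H)
      moreover have "((c, t, v), (c, t, v')) \<in> parcs ?H"
        using in_verts(1) tree(2) unfolding arc_H in_H by blast
      ultimately show ?thesis by simp
    next
      case forward
      then show ?thesis using cycle_arc_if_lift[OF L in_verts] by blast
    next
      case backward
      then show ?thesis
        using cycle_arc_if_lift[OF lift_sym[OF L] in_verts(2,1)] H_sym by blast
    qed
  qed
  define \<Phi> where "\<Phi> = (\<lambda>(c, t, v). ((t mod m, v), pot c t v mod int n))"
  have "pair_iso \<Phi> ?H ?W"
  proof (rule pair_isoI)
    show "bij_betw \<Phi> (pverts ?H) (pverts ?W)"
    proof (rule bij_betw_imageI)
      show "inj_on \<Phi> (pverts ?H)"
      proof (rule inj_onI)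
        fix x y assume xy: "x \<in> pverts ?H" "y \<in> pverts ?H" "\<Phi> x = \<Phi> y"
        obtain c t v c' t' v' where "x = (c, t, v)" "y = (c', t', v')" by (metis prod.exhaust)
        then show "x = y" using xy pot_inj[of c c' t t' v] by (auto simp: \<Phi>_def in_H cong_def)
      qed
      show "\<Phi> ` pverts ?H = pverts ?W"
      proof
        show "\<Phi> ` pverts ?H \<subseteq> pverts ?W"
        proof
          fix y assume "y \<in> \<Phi> ` pverts ?H"
          then obtain c t v where "(c, t, v) \<in> pverts ?H" "y = \<Phi> (c, t, v)" by auto
          then show "y \<in> pverts ?W"
            using n m_pos by (auto simp: \<Phi>_def voltage_graph_def in_H)
        qed
        show "pverts ?W \<subseteq> \<Phi> ` pverts ?H"
        proof
          fix y assume "y \<in> pverts ?W"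
          then obtain j v x where y: "y = ((j, v), x)" "j < m" "v \<in> pverts (T j)" "0 \<le> x" "x < int n"
            by (cases y) (auto simp: voltage_graph_def)
          \<comment> \<open>Subtract from the height x what the tree and the partial turn
            contribute. The remainder splits into a coset c and a number q of completed turns, which
            gives the index q * m + j.\<close>
          obtain c q where cq: "c < g" "q < k"
            "[int c + int q * s = x - \<sigma> j - \<phi> j v] (mod int n)"
            using residue_decomposition_surj[OF n g k] by metis
          let ?t = "q * m + j"
          have t: "?t mod m = j" "?t div m = q" using y(2) m_pos by (auto simp: div_mult_self3)
          have "?t < Suc q * m" using y(2) by simp
          also have "\<dots> \<le> ?N" using cq(2) by (intro mult_le_mono1) simp
          finally have t_lt: "?t < ?N" .
          have "[pot c ?t v = x] (mod int n)"
            using cong_add[OF cq(3) cong_refl[of "\<sigma> j + \<phi> j v"]] \<sigma>_decomp[of ?t] t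
            by (simp add: pot_def add.assoc)
          then have "\<Phi> (c, ?t, v) = y"
            using y t by (simp add: \<Phi>_def cong_def)
          moreover have "(c, ?t, v) \<in> pverts ?H" using cq t t_lt y by (simp add: in_H)
          ultimately show "y \<in> \<Phi> ` pverts ?H" by blast
        qed
      qed
    qed
    show "(x, y) \<in> parcs ?H \<longleftrightarrow> (\<Phi> x, \<Phi> y) \<in> parcs ?W"
      if "x \<in> pverts ?H" "y \<in> pverts ?H" for x y
    proof -
      obtain c t v c' t' v' where xy: "x = (c, t, v)" "y = (c', t', v')" by (metis prod.exhaust)
      have "(\<Phi> x, \<Phi> y) \<in> parcs ?W \<longleftrightarrow> ?lift c t v c' t' v'"
        using n by (auto simp: xy \<Phi>_def voltage_graph_def cong_def mod_add_left_eq)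
      then show ?thesis using that lift_if_arc arc_if_lift unfolding xy by blast
    qed
  qed
  then show thesis by (rule that)
qed

end

section \<open>The product with a component\<close>

lemma bridge_commute: "sym E \<Longrightarrow> bridge E u v \<longleftrightarrow> bridge E v u"
proof -
  assume "sym E"
  then have "sym (E - {(u, v), (v, u)})" by (auto simp: sym_def)
  then have "sym ((E - {(u, v), (v, u)})\<^sup>*)" by (rule sym_rtrancl)
  moreover have "E - {(u, v), (v, u)} = E - {(v, u), (u, v)}" by auto
  ultimately show ?thesis unfolding bridge_def by (metis symD)
qed

text \<open>A walk avoiding the edge is carried to one avoiding the image of the edge, since
  \<open>f\<close> is injective on vertices.\<close>

lemma not_bridge_pair_iso:
  assumes f: "pair_iso f G H" and G: "parcs G \<subseteq> pverts G \<times> pverts G"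
    and uv: "u \<in> pverts G" "v \<in> pverts G" and nb: "\<not> bridge (parcs G) u v"
  shows "\<not> bridge (parcs H) (f u) (f v)"
proof -
  have inj: "inj_on f (pverts G)" using pair_iso_bij[OF f] by (simp add: bij_betw_def)
  have "(f v, f u) \<in> (parcs H - {(f u, f v), (f v, f u)})\<^sup>*"
    using nb[unfolded bridge_def not_not]
  proof (rule rtrancl_map)
    fix x y assume xy: "(x, y) \<in> parcs G - {(u, v), (v, u)}"
    then have V: "x \<in> pverts G" "y \<in> pverts G" using G by auto
    then have "(f x, f y) \<in> parcs H" using xy pair_iso_arc_iff[OF f] by blast
    moreover have "(f x, f y) \<notin> {(f u, f v), (f v, f u)}"
      using xy V uv inj_onD[OF inj] by blast
    ultimately show "(f x, f y) \<in> (parcs H - {(f u, f v), (f v, f u)})\<^sup>*" by blast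
  qed
  then show ?thesis by (simp add: bridge_def)
qed

lemma bridge_pair_iso:
  assumes f: "pair_iso f G H"
    and G: "parcs G \<subseteq> pverts G \<times> pverts G" and H: "parcs H \<subseteq> pverts H \<times> pverts H"
    and uv: "u \<in> pverts G" "v \<in> pverts G"
  shows "bridge (parcs H) (f u) (f v) \<longleftrightarrow> bridge (parcs G) u v"
proof -
  have "the_inv_into (pverts G) f (f x) = x" if "x \<in> pverts G" for x
    using pair_iso_bij[OF f] that by (simp add: bij_betw_def the_inv_into_f_f)
  then show ?thesis
    using not_bridge_pair_iso[OF f G uv] uv
      not_bridge_pair_iso[OF pair_iso_inv[OF f] H pair_iso_in_verts[OF f uv(1)]
        pair_iso_in_verts[OF f uv(2)]]
    by auto
qed

lemma arc_on_graph_cycle_iff: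
  assumes "parcs G \<subseteq> pverts G \<times> pverts G" "(u, v) \<in> parcs G" "u \<noteq> v"
  shows "(\<exists>p. graph_cycle G p \<and> (u, v) \<in> set p) \<longleftrightarrow> \<not> bridge (parcs G) u v"
  using not_bridge_if_graph_cycle graph_cycle_if_not_bridge[OF assms] by metis

lemma oriented_graph_wf: "oriented_graph D \<Longrightarrow> parcs D \<subseteq> pverts D \<times> pverts D"
  by (auto simp: oriented_graph_def pair_digraph_def pair_fin_digraph_def
      dest: pair_wf_digraph.in_arcsD1 pair_wf_digraph.in_arcsD2)

lemma oriented_graph_asym: "oriented_graph D \<Longrightarrow> (u, v) \<in> parcs D \<Longrightarrow> (v, u) \<notin> parcs D"
  by (auto simp: oriented_graph_def)

text \<open>Recasts the cycle part through bridges, which isomorphisms respect. Asymmetry of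
  \<open>D\<close> supplies the distinct ends that \<open>arc_on_graph_cycle_iff\<close> asks
  for.\<close>

lemma parcs_cycle_part:
  assumes "oriented_graph D"
  shows "parcs (cycle_part D) = {(u, v) \<in> parcs D. \<not> bridge (parcs (und D)) u v}"
proof -
  have "(\<exists>p. graph_cycle (und D) p \<and> (u, v) \<in> set p) \<longleftrightarrow> \<not> bridge (parcs (und D)) u v"
    if "(u, v) \<in> parcs D" for u v
    using that oriented_graph_wf[OF assms] oriented_graph_asym[OF assms]
    by (intro arc_on_graph_cycle_iff) (auto simp: parcs_und)
  then show ?thesis unfolding cycle_part_def Let_def by auto
qed

section \<open>The cycle of a component and its direction\<close>

context cycle_of_trees
begin

text \<open>Tree arcs are bridges, cycle arcs in either direction are not, and there are no
  others.\<close>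

lemma not_bridge_iff_cycle_arc:
  assumes "(x, y) \<in> parcs U"
  shows "\<not> bridge (parcs U) x y \<longleftrightarrow>
    (\<exists>j<m. (x, y) = (a j, a (Suc j mod m)) \<or> (x, y) = (a (Suc j mod m), a j))"
proof
  assume nb: "\<not> bridge (parcs U) x y"
  obtain i u j v where xy: "x = (i, u)" "y = (j, v)" by (metis surj_pair)
  have "\<not> (i = j \<and> (u, v) \<in> parcs (T i))"
    using nb assms bridge_tree_arc[of i u v] unfolding xy in_parcs_unicyclic by blast
  then have "i < m \<and> j < m \<and> u = w i \<and> v = w j \<and> (j = Suc i mod m \<or> i = Suc j mod m)"
    using assms unfolding xy in_parcs_unicyclic by blast
  then show "\<exists>j<m. (x, y) = (a j, a (Suc j mod m)) \<or> (x, y) = (a (Suc j mod m), a j)"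
    unfolding xy by blast
next
  have "sym (parcs U)" using unicyclic_sym by (auto intro: symI)
  then show "\<not> bridge (parcs U) x y"
    if "\<exists>j<m. (x, y) = (a j, a (Suc j mod m)) \<or> (x, y) = (a (Suc j mod m), a j)"
    using that not_bridge_cycle_arc bridge_commute by fast
qed

text \<open>With \<open>b j\<close> the preimage of \<open>a j\<close>, the bridge criterion pulls
  back along \<open>f\<close>, and injectivity replaces equations between images by equations
  between vertices of \<open>D\<close>.\<close>

lemma cycle_part_arcs:
  assumes D: "oriented_graph D" and f: "pair_iso f (und D) U"
    and b: "\<And>j. j < m \<Longrightarrow> b j \<in> pverts D \<and> f (b j) = a j"
  shows "parcs (cycle_part D) = {(u, v) \<in> parcs D.
    \<exists>j<m. (u, v) = (b j, b (Suc j mod m)) \<or> (u, v) = (b (Suc j mod m), b j)}"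
proof -
  have inj: "inj_on f (pverts D)" using pair_iso_bij[OF f] by (simp add: bij_betw_def)
  have eq: "f x = a j \<longleftrightarrow> x = b j" if "x \<in> pverts D" "j < m" for x j
    using b[OF that(2)] inj_onD[OF inj] that(1) by metis
  have "\<not> bridge (parcs (und D)) u v \<longleftrightarrow>
      (\<exists>j<m. (u, v) = (b j, b (Suc j mod m)) \<or> (u, v) = (b (Suc j mod m), b j))"
    if uv: "(u, v) \<in> parcs D" for u v
  proof -
    have V: "u \<in> pverts D" "v \<in> pverts D" using uv oriented_graph_wf[OF D] by auto
    have arc: "(f u, f v) \<in> parcs U"
      using pair_iso_arc_iff[OF f] uv V by (simp add: parcs_und)
    have bridge: "bridge (parcs U) (f u) (f v) \<longleftrightarrow> bridge (parcs (und D)) u v"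
      using V oriented_graph_wf[OF D]
      by (intro bridge_pair_iso[OF f _ unicyclic_wf]) (auto simp: parcs_und)
    have "\<not> bridge (parcs (und D)) u v \<longleftrightarrow>
        (\<exists>j<m. (f u, f v) = (a j, a (Suc j mod m)) \<or> (f u, f v) = (a (Suc j mod m), a j))"
      unfolding bridge[symmetric] by (rule not_bridge_iff_cycle_arc[OF arc])
    also have "\<dots> \<longleftrightarrow>
        (\<exists>j<m. (u, v) = (b j, b (Suc j mod m)) \<or> (u, v) = (b (Suc j mod m), b j))"
    proof (intro ex_cong1 conj_cong refl)
      fix j assume j: "j < m"
      then have lt: "Suc j mod m < m" using m_pos by simp
      show "(f u, f v) = (a j, a (Suc j mod m)) \<or> (f u, f v) = (a (Suc j mod m), a j) \<longleftrightarrow>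
          (u, v) = (b j, b (Suc j mod m)) \<or> (u, v) = (b (Suc j mod m), b j)"
        by (simp only: prod.inject[of "f u"] prod.inject[of u] eq[OF V(1) j] eq[OF V(2) j]
            eq[OF V(1) lt] eq[OF V(2) lt])
    qed
    finally show ?thesis .
  qed
  then show ?thesis unfolding parcs_cycle_part[OF D] by blast
qed

text \<open>Every vertex of the strongly oriented cycle has an outgoing cycle arc, and no edge carries
  arcs in both directions, so the orientation propagates from one cycle edge to the next.\<close>
lemma cycle_orientation:
  assumes D: "oriented_graph D" and f: "pair_iso f (und D) U"
    and b: "\<And>j. j < m \<Longrightarrow> b j \<in> pverts D \<and> f (b j) = a j"
    and cyc: "strongly_oriented_cycle (cycle_part D)"
  shows "(\<forall>j<m. (b j, b (Suc j mod m)) \<in> parcs D) \<or> (\<forall>j<m. (b (Suc j mod m), b j) \<in> parcs D)"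
proof -
  let ?A = "parcs (cycle_part D)"
  have A: "?A = {(u, v) \<in> parcs D.
      \<exists>j<m. (u, v) = (b j, b (Suc j mod m)) \<or> (u, v) = (b (Suc j mod m), b j)}"
    by (rule cycle_part_arcs[OF D f b])
  have b_inj: "b i = b j \<longleftrightarrow> i = j" if "i < m" "j < m" for i j
    using b[OF that(1)] b[OF that(2)] by (metis prod.inject)
  have Suc_inj: "Suc i mod m = Suc j mod m \<longleftrightarrow> i = j" if "i < m" "j < m" for i j
    using that by (simp add: mod_Suc)
  have edge: "(b j, b (Suc j mod m)) \<in> parcs D \<or> (b (Suc j mod m), b j) \<in> parcs D"
    if j: "j < m" for j
  proof -
    have "(b j, b (Suc j mod m)) \<in> parcs (und D)"
      using pair_iso_arc_iff[OF f, of "b j" "b (Suc j mod m)"] b[OF j] b[of "Suc j mod m"]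
        cycle_arc[OF j] m_pos by simp
    then show ?thesis by (auto simp: parcs_und)
  qed
  \<comment> \<open>The vertices of the cycle part are all ends of its arcs, while strong
    orientation makes all of them tails; hence each has an outgoing arc.\<close>
  obtain p where "?A = set p" "pverts (cycle_part D) = fst ` set p"
    using cyc by (auto simp: strongly_oriented_cycle_def)
  moreover have "pverts (cycle_part D) = fst ` ?A \<union> snd ` ?A"
    by (simp add: cycle_part_def Let_def)
  ultimately have "fst ` ?A \<union> snd ` ?A = fst ` ?A" by simp
  moreover have "b j \<in> fst ` ?A \<union> snd ` ?A" if "j < m" for j
  proof -
    have "(b j, b (Suc j mod m)) \<in> ?A \<or> (b (Suc j mod m), b j) \<in> ?A"
      using edge[OF that] that unfolding A by blast
    then show ?thesis by force
  qed
  ultimately have out: "\<exists>v. (b j, v) \<in> ?A" if "j < m" for j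
    using that by fastforce
  have step: "(b (Suc j mod m), b (Suc (Suc j mod m) mod m)) \<in> parcs D"
    if j: "j < m" and fwd: "(b j, b (Suc j mod m)) \<in> parcs D" for j
  proof -
    have lt: "Suc j mod m < m" using m_pos by simp
    obtain v where "(b (Suc j mod m), v) \<in> ?A" using out[OF lt] by blast
    then obtain i where i: "i < m" and D': "(b (Suc j mod m), v) \<in> parcs D"
      and "(b (Suc j mod m), v) = (b i, b (Suc i mod m)) \<or>
        (b (Suc j mod m), v) = (b (Suc i mod m), b i)"
      unfolding A by blast
    then consider "b (Suc j mod m) = b i" "v = b (Suc i mod m)"
      | "b (Suc j mod m) = b (Suc i mod m)" "v = b i"
      by blast
    then show ?thesis
    proof cases
      case 1
      then have eq: "i = Suc j mod m" using b_inj[OF lt i] by blast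
      show ?thesis using D' unfolding 1(2) eq .
    next
      case 2
      \<comment> \<open>Here the outgoing arc would run back to \<open>b j\<close>, against the
        given forward arc.\<close>
      have "Suc i mod m < m" using m_pos by simp
      then have eq: "i = j" using 2(1) b_inj[OF lt] Suc_inj[OF j i] by blast
      show ?thesis using D' oriented_graph_asym[OF D fwd] unfolding 2(2) eq by blast
    qed
  qed
  \<comment> \<open>One forward edge makes all edges forward: j + m - i applications of
    \<open>step\<close> lead from i to j modulo m.\<close>
  have all: "(b j, b (Suc j mod m)) \<in> parcs D"
    if i: "i < m" "(b i, b (Suc i mod m)) \<in> parcs D" and j: "j < m" for i j
  proof -
    have "(b ((i + t) mod m), b (Suc ((i + t) mod m) mod m)) \<in> parcs D" for t
    proof (induction t)
      case (Suc t)
      have "(i + Suc t) mod m = Suc ((i + t) mod m) mod m" by (simp add: mod_Suc_eq)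
      then show ?case using step[OF _ Suc] m_pos by simp
    qed (use i in simp)
    from this[of "j + m - i"] show ?thesis using i j by simp
  qed
  \<comment> \<open>If no edge points forward, then by \<open>edge\<close> all of them point
    backward.\<close>
  then show ?thesis using edge by blast
qed

end

section \<open>Labelling a strongly oriented cycle by residues\<close>

lemma strongly_oriented_cycle_wf:
  assumes "strongly_oriented_cycle C"
  shows "parcs C \<subseteq> pverts C \<times> pverts C"
proof
  obtain p where p: "pre_digraph.cycle (with_proj C) p" "parcs C = set p" "pverts C = fst ` set p"
    using assms by (auto simp: strongly_oriented_cycle_def)
  obtain f where "p \<noteq> []" and f: "\<And>i. i < length p \<Longrightarrow> p ! i = (f i, f (Suc i mod length p))"
    using cycle_nthE[OF p(1)] by metis
  have "f i \<in> pverts C" if "i < length p" for i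
    unfolding p(3) using f[OF that] nth_mem[OF that] by (metis fst_conv image_eqI)
  moreover fix e assume "e \<in> parcs C"
  then obtain i where "i < length p" "e = p ! i" by (auto simp: p(2) in_set_conv_nth)
  ultimately show "e \<in> pverts C \<times> pverts C" using f \<open>p \<noteq> []\<close> by simp
qed

text \<open>The label of a vertex is its position along the cycle. The congruence also covers the
  loop for n = 1 and the pair of opposite arcs for n = 2.\<close>

lemma strongly_oriented_cycle_labelling:
  assumes C: "strongly_oriented_cycle C" and n: "card (pverts C) = n"
  obtains \<beta> where "bij_betw \<beta> (pverts C) {0..<int n}"
    and "\<And>x y. x \<in> pverts C \<Longrightarrow> y \<in> pverts C \<Longrightarrow>
      (x, y) \<in> parcs C \<longleftrightarrow> [\<beta> y = \<beta> x + 1] (mod int n)"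
proof -
  obtain p where p: "pre_digraph.cycle (with_proj C) p" "parcs C = set p" "pverts C = fst ` set p"
    using C by (auto simp: strongly_oriented_cycle_def)
  obtain f where inj: "inj_on f {..<length p}"
    and f: "\<And>i. i < length p \<Longrightarrow> p ! i = (f i, f (Suc i mod length p))"
    using cycle_nthE[OF p(1)] by metis
  have "set p = (\<lambda>i. p ! i) ` {..<length p}" by (auto simp: set_conv_nth)
  then have arcs: "parcs C = (\<lambda>i. (f i, f (Suc i mod length p))) ` {..<length p}"
    using f p(2) by auto
  then have V: "pverts C = f ` {..<length p}" using p(2,3) by (auto simp: image_image)
  then have len: "length p = n" using n card_image[OF inj] by simp
  have bij: "bij_betw f {..<n} (pverts C)" using inj V len by (simp add: bij_betw_def)
  let ?g = "the_inv_into {..<n} f"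
  have g: "bij_betw ?g (pverts C) {..<n}" using bij by (rule bij_betw_the_inv_into)
  have "bij_betw int {..<n} {0..<int n}"
    by (auto simp: bij_betw_def inj_on_def image_int_atLeastLessThan lessThan_atLeast0)
  then have "bij_betw (int \<circ> ?g) (pverts C) {0..<int n}" using g by (rule bij_betw_trans[rotated])
  moreover have "(x, y) \<in> parcs C \<longleftrightarrow> [(int \<circ> ?g) y = (int \<circ> ?g) x + 1] (mod int n)"
    if xy: "x \<in> pverts C" "y \<in> pverts C" for x y
  proof -
    obtain i j where ij: "i < n" "j < n" "x = f i" "y = f j" using xy V len by auto
    then have gi: "?g x = i" "?g y = j"
      using inj len by (auto simp: the_inv_into_f_f)
    have "(x, y) \<in> parcs C \<longleftrightarrow> j = Suc i mod n"
    proof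
      assume "(x, y) \<in> parcs C"
      then obtain i' where "i' < n" "f i = f i'" "f j = f (Suc i' mod n)"
        using arcs ij len by auto
      moreover have "Suc i' mod n < n" using ij by simp
      ultimately show "j = Suc i mod n" using ij inj len by (metis inj_onD lessThan_iff)
    qed (use arcs ij len in auto)
    also have "\<dots> \<longleftrightarrow> [j = Suc i] (mod n)" using ij by (simp add: cong_def)
    also have "\<dots> \<longleftrightarrow> [int j = int (Suc i)] (mod int n)" by (simp only: cong_int_iff)
    finally show ?thesis by (simp add: gi add.commute)
  qed
  ultimately show thesis by (rule that)
qed

section \<open>The product over a single component\<close>

lemma in_parcs_und_digraph_product:
  "((u, x), (v, y)) \<in> parcs (und (digraph_product D V h)) \<longleftrightarrow>
    (u, v) \<in> parcs D \<and> (x, y) \<in> parcs (h (u, v)) \<or>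
    (v, u) \<in> parcs D \<and> (y, x) \<in> parcs (h (v, u))"
  by (auto simp: parcs_und digraph_product_def)

text \<open>Labels turn the product into a voltage graph with voltages 1 and -1, to which
  \<open>voltage_graph_iso\<close> applies. That \<open>k\<close> is nonzero is recorded so that the
  repeated list is again a cycle of trees.\<close>

lemma unicyclic_product_iso:
  fixes D :: "'a pair_pre_digraph" and C :: "'v pair_pre_digraph"
    and ts :: "('t pair_pre_digraph \<times> 't) list"
  assumes n: "n \<noteq> 0" "card (pverts C) = n" and C: "strongly_oriented_cycle C"
    and ts: "cycle_of_trees ts" and D: "oriented_graph D"
    and iso: "digraph_iso (und D) (unicyclic ts)"
    and cyc: "strongly_oriented_cycle (cycle_part D)"
    and h: "\<And>e. e \<in> parcs D \<Longrightarrow> h e \<in> {C, reverse_digraph C}"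
    and r: "r = card {e \<in> parcs (cycle_part D). h e = reverse_digraph C}"
    and k: "k = card (generate (integer_mod_group n) {(int (length ts) - 2 * int r) mod int n})"
  obtains F where "pair_iso F (und (digraph_product D (pverts C) h))
    (copies (n div k) (unicyclic (list_power ts k)))" and "k \<noteq> 0"
proof -
  interpret cycle_of_trees ts by (rule ts)
  obtain f where f: "pair_iso f (und D) U" using iso by (rule digraph_iso_imp_pair_iso)
  define f' where "f' = the_inv_into (pverts D) f"
  have f_bij: "bij_betw f (pverts D) (pverts U)" using pair_iso_bij[OF f] by simp
  have f'f: "f' (f u) = u" if "u \<in> pverts D" for u
    using f_bij that by (simp add: f'_def bij_betw_def the_inv_into_f_f)
  have ff': "f (f' x) = x" "f' x \<in> pverts D" if "x \<in> pverts U" for x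
    using f_bij bij_betw_the_inv_into[OF f_bij] that
    by (auto simp: f'_def bij_betw_def f_the_inv_into_f)
  define b where "b j = f' (a j)" for j
  have b: "b j \<in> pverts D \<and> f (b j) = a j" if "j < m" for j
    using ff' that root_in_tree by (simp add: b_def)
  have b_inj: "b i = b j \<longleftrightarrow> i = j" if "i < m" "j < m" for i j
    using b[OF that(1)] b[OF that(2)] by (metis prod.inject)
  \<comment> \<open>For n at most 2 the cycle equals its reverse and every arc of \<open>D\<close>
    gets -1, which agrees with the count \<open>r\<close>.\<close>
  define sgn_h :: "'a \<times> 'a \<Rightarrow> int" where "sgn_h e = (if h e = reverse_digraph C then - 1 else 1)" for e
  \<comment> \<open>Extends the signs antisymmetrically to both directions of each edge.\<close>
  define \<delta> where "\<delta> u v = (if (u, v) \<in> parcs D then sgn_h (u, v) else - sgn_h (v, u))" for u v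
  define \<epsilon> where "\<epsilon> x y = \<delta> (f' x) (f' y)" for x y
  note asym = oriented_graph_asym[OF D]
  have \<delta>_antisym: "\<delta> v u = - \<delta> u v" if "(u, v) \<in> parcs (und D)" for u v
    using that asym by (auto simp: \<delta>_def parcs_und)
  have antisym: "\<epsilon> y x = - \<epsilon> x y" if "(x, y) \<in> parcs U" for x y
  proof -
    have "x \<in> pverts U" "y \<in> pverts U" using that unicyclic_wf by auto
    then have "(f' x, f' y) \<in> parcs (und D)"
      using pair_iso_arc_iff[OF f, of "f' x" "f' y"] that ff' by simp
    then show ?thesis unfolding \<epsilon>_def by (rule \<delta>_antisym)
  qed
  let ?A = "parcs (cycle_part D)"
  have A: "?A = {(u, v) \<in> parcs D.
      \<exists>j<m. (u, v) = (b j, b (Suc j mod m)) \<or> (u, v) = (b (Suc j mod m), b j)}"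
    by (rule cycle_part_arcs[OF D f b])
  \<comment> \<open>\<open>d\<close> enumerates the arcs of the cycle of \<open>D\<close>; the sign
    z records whether their common direction agrees with the numbering by \<open>b\<close>.\<close>
  obtain d :: "nat \<Rightarrow> 'a \<times> 'a" and z :: int where z: "z = 1 \<or> z = - 1"
    and d: "inj_on d {..<m}" "?A = d ` {..<m}"
    and \<delta>_cycle: "\<And>j. j < m \<Longrightarrow> \<delta> (b j) (b (Suc j mod m)) = z * sgn_h (d j)"
  proof (cases "\<forall>j<m. (b j, b (Suc j mod m)) \<in> parcs D")
    case True
    show thesis
    proof (rule that)
      let ?d = "\<lambda>j. (b j, b (Suc j mod m))"
      show "(1::int) = 1 \<or> (1::int) = - 1" by simp
      show "inj_on ?d {..<m}" using b_inj by (auto simp: inj_on_def)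
      show "?A = ?d ` {..<m}" 
        unfolding A set_eq_iff using True asym
        by (simp add: image_iff Bex_def split_paired_all del: split_paired_All split_paired_Ex) blast
      show "\<delta> (b j) (b (Suc j mod m)) = 1 * sgn_h (?d j)" if "j < m" for j
        using True that by (simp add: \<delta>_def)
    qed
  next
    case False
    then have bwd: "(b (Suc j mod m), b j) \<in> parcs D" if "j < m" for j
      using cycle_orientation[OF D f b cyc] that by blast
    show thesis
    proof (rule that)
      let ?d = "\<lambda>j. (b (Suc j mod m), b j)"
      show "(- 1::int) = 1 \<or> (- 1::int) = - 1" by simp
      show "inj_on ?d {..<m}" using b_inj by (auto simp: inj_on_def)
      show "?A = ?d ` {..<m}" 
        unfolding A set_eq_iff using bwd asym
        by (simp add: image_iff Bex_def split_paired_all del: split_paired_All split_paired_Ex) blast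
      show "\<delta> (b j) (b (Suc j mod m)) = - 1 * sgn_h (?d j)" if "j < m" for j
        using bwd[OF that] asym by (simp add: \<delta>_def)
    qed
  qed
  define s where "s = (\<Sum>j<m. \<epsilon> (a j) (a (Suc j mod m)))"
  have "{e \<in> ?A. h e = reverse_digraph C} = d ` {j \<in> {..<m}. h (d j) = reverse_digraph C}"
    using d(2) by auto
  then have r': "r = card {j \<in> {..<m}. h (d j) = reverse_digraph C}"
    unfolding r by (simp only:) (intro card_image inj_on_subset[OF d(1)] Collect_restrict)
  have "s = (\<Sum>j<m. z * sgn_h (d j))"
    unfolding s_def \<epsilon>_def using \<delta>_cycle by (simp add: b_def)
  \<comment> \<open>Each sign is 1 minus twice the indicator of a reversed arc, and r counts the
    reversed arcs of the cycle.\<close>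
  also have "\<dots> = z * (\<Sum>j<m. 1 - 2 * (if h (d j) = reverse_digraph C then 1 else 0))"
    unfolding sum_distrib_left by (intro sum.cong) (auto simp: sgn_h_def)
  also have "\<dots> = z * (int m - 2 * int r)"
    by (simp add: sum_subtractf r' sum.If_cases Int_def conj_commute flip: sum_distrib_left)
  finally have s: "s = z * (int m - 2 * int r)" .
  define g where "g = nat (gcd (int n) s)"
  \<comment> \<open>The sign z disappears in the gcd, so s and m - 2r generate subgroups of the same
    order.\<close>
  have "gcd (int n) s = gcd (int n) (int m - 2 * int r)"
    using z by (elim disjE) (simp_all add: s, metis gcd_neg2_int minus_diff_eq)
  then have kg: "k = n div g"
    unfolding k g_def by (simp add: card_generate_integer_mod_group[OF n(1)])
  have "int g dvd int n" by (simp add: g_def)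
  then have gk: "g * k = n" using kg by auto
  then have k_nz: "k \<noteq> 0" and g_eq: "n div k = g" using n(1) by auto
  obtain \<Phi> where \<Phi>: "pair_iso \<Phi> (copies g (unicyclic (list_power ts k))) (voltage_graph U n \<epsilon>)"
    using voltage_graph_iso[OF antisym n(1) s_def g_def kg] by blast
  obtain \<beta> where \<beta>: "bij_betw \<beta> (pverts C) {0..<int n}"
    and \<beta>_arc: "\<And>x y. x \<in> pverts C \<Longrightarrow> y \<in> pverts C \<Longrightarrow>
      (x, y) \<in> parcs C \<longleftrightarrow> [\<beta> y = \<beta> x + 1] (mod int n)"
    using strongly_oriented_cycle_labelling[OF C n(2)] by blast
  \<comment> \<open>Exchanges the ends of an arc: the reversed cycle, and arcs of \<open>D\<close>
    read backwards, carry the opposite voltage.\<close>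
  have shift: "[y = x + t] (mod int n) \<longleftrightarrow> [x = y + - t] (mod int n)" for x y t :: int
    by (subst cong_sym_eq) (simp add: cong_iff_dvd_diff diff_diff_eq2 add_diff_eq)
  have h_arc: "(x, y) \<in> parcs (h e) \<longleftrightarrow> [\<beta> y = \<beta> x + sgn_h e] (mod int n)"
    if "e \<in> parcs D" "x \<in> pverts C" "y \<in> pverts C" for e x y
  proof (cases "h e = reverse_digraph C")
    case True
    then have "(x, y) \<in> parcs (h e) \<longleftrightarrow> (y, x) \<in> parcs C" by (simp add: reverse_digraph_def)
    then show ?thesis using \<beta>_arc that shift True by (simp add: sgn_h_def)
  next
    case False
    then have "h e = C" using h that(1) by blast
    then show ?thesis using \<beta>_arc that False by (simp add: sgn_h_def)
  qed
  let ?P = "und (digraph_product D (pverts C) h)"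
  have "pair_iso (map_prod f \<beta>) ?P (voltage_graph U n \<epsilon>)"
  proof (rule pair_isoI)
    show "bij_betw (map_prod f \<beta>) (pverts ?P) (pverts (voltage_graph U n \<epsilon>))"
      using f_bij \<beta> by (simp add: digraph_product_def voltage_graph_def bij_betw_map_prod)
    fix ux vy assume "ux \<in> pverts ?P" "vy \<in> pverts ?P"
    then obtain u x v y where uv: "ux = (u, x)" "vy = (v, y)"
      and V: "u \<in> pverts D" "v \<in> pverts D" "x \<in> pverts C" "y \<in> pverts C"
      by (auto simp: digraph_product_def)
    have \<beta>_in: "\<beta> x \<in> {0..<int n}" "\<beta> y \<in> {0..<int n}"
      using \<beta> V by (auto simp: bij_betw_def)
    have "(map_prod f \<beta> ux, map_prod f \<beta> vy) \<in> parcs (voltage_graph U n \<epsilon>) \<longleftrightarrow>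
        (u, v) \<in> parcs (und D) \<and> [\<beta> y = \<beta> x + \<delta> u v] (mod int n)"
      using V \<beta>_in pair_iso_arc_iff[OF f, of u v]
      by (simp add: uv in_parcs_voltage_graph \<epsilon>_def f'f)
    also have "\<dots> \<longleftrightarrow> (ux, vy) \<in> parcs ?P"
    proof -
      consider (fwd) "(u, v) \<in> parcs D" "(v, u) \<notin> parcs D"
        | (bwd) "(u, v) \<notin> parcs D" "(v, u) \<in> parcs D"
        | (none) "(u, v) \<notin> parcs D" "(v, u) \<notin> parcs D"
        using asym by blast
      then show ?thesis
      proof cases
        case fwd
        then show ?thesis using h_arc[of "(u, v)" x y] V
          unfolding uv in_parcs_und_digraph_product unfolding parcs_und by (simp add: \<delta>_def)
      next
        case bwd
        then show ?thesis using h_arc[of "(v, u)" y x] V shift[of "\<beta> x" "\<beta> y" "sgn_h (v, u)"]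
          unfolding uv in_parcs_und_digraph_product unfolding parcs_und by (simp add: \<delta>_def)
      next
        case none
        then show ?thesis
          unfolding uv in_parcs_und_digraph_product unfolding parcs_und by simp
      qed
    qed
    finally show "(ux, vy) \<in> parcs ?P \<longleftrightarrow>
        (map_prod f \<beta> ux, map_prod f \<beta> vy) \<in> parcs (voltage_graph U n \<epsilon>)" by simp
  qed
  then have "pair_iso (the_inv_into (pverts (copies g (unicyclic (list_power ts k)))) \<Phi> \<circ> map_prod f \<beta>)
      ?P (copies g (unicyclic (list_power ts k)))"
    by (rule pair_iso_comp) (rule pair_iso_inv[OF \<Phi>])
  then show thesis using that k_nz g_eq by simp
qed

section \<open>Assembly of the components\<close>

lemma cycle_of_trees_list_power:
  assumes "cycle_of_trees ts" "k \<noteq> 0"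
  shows "cycle_of_trees (list_power ts k)"
proof
  interpret cycle_of_trees ts by fact
  have "m \<le> k * m" using assms(2) by (cases k) auto
  then show "3 \<le> length (list_power ts k)"
    unfolding length_list_power using length_ge by linarith
  have "set (list_power ts k) \<subseteq> set ts" by (auto simp: list_power_def split: if_splits)
  then show "graph_tree T \<and> w \<in> pverts T" if "(T, w) \<in> set (list_power ts k)" for T w
    using that graph_trees by blast
qed

lemma disjoint_sum_wf:
  assumes "\<And>i. i \<in> I \<Longrightarrow> parcs (G i) \<subseteq> pverts (G i) \<times> pverts (G i)"
  shows "parcs (disjoint_sum I G) \<subseteq> pverts (disjoint_sum I G) \<times> pverts (disjoint_sum I G)"
  using assms by (fastforce simp: disjoint_sum_def)

lemma digraph_product_wf:
  assumes "parcs D \<subseteq> pverts D \<times> pverts D"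
    and "\<And>e. e \<in> parcs D \<Longrightarrow> parcs (h e) \<subseteq> V \<times> V"
  shows "parcs (und (digraph_product D V h)) \<subseteq>
    pverts (und (digraph_product D V h)) \<times> pverts (und (digraph_product D V h))"
proof -
  have "parcs (digraph_product D V h) \<subseteq> (pverts D \<times> V) \<times> (pverts D \<times> V)"
  proof
    fix e assume "e \<in> parcs (digraph_product D V h)"
    then obtain u x v y where "e = ((u, x), (v, y))" "(u, v) \<in> parcs D" "(x, y) \<in> parcs (h (u, v))"
      by (auto simp: digraph_product_def)
    then show "e \<in> (pverts D \<times> V) \<times> (pverts D \<times> V)" using assms by blast
  qed
  moreover have "pverts (und (digraph_product D V h)) = pverts D \<times> V"
    by (simp add: digraph_product_def)
  ultimately show ?thesis unfolding parcs_und by auto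
qed

theorem theorem3p2:
  fixes n l :: nat
    and V :: "'v set"
    and C :: "'v pair_pre_digraph"
    and ts :: "nat \<Rightarrow> ('t pair_pre_digraph \<times> 't) list"
    and D :: "nat \<Rightarrow> 'a pair_pre_digraph"
    and h :: "(nat \<times> 'a) \<times> (nat \<times> 'a) \<Rightarrow> 'v pair_pre_digraph"
    and r k :: "nat \<Rightarrow> nat"
  assumes "1 \<le> n" and "card V = n"
    and "strongly_oriented_cycle C" and "pverts C = V"
    and "1 \<le> l"
    and "\<And>i. i < l \<Longrightarrow> 3 \<le> length (ts i)"
    and "\<And>i T w. i < l \<Longrightarrow> (T, w) \<in> set (ts i) \<Longrightarrow> graph_tree T \<and> w \<in> pverts T"
    and "\<And>i. i < l \<Longrightarrow> oriented_graph (D i)"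
    and "\<And>i. i < l \<Longrightarrow> digraph_iso (und (D i)) (unicyclic (ts i))"
    and "\<And>i. i < l \<Longrightarrow> strongly_oriented_cycle (cycle_part (D i))"
    and "\<And>e. e \<in> parcs (disjoint_sum {..<l} D) \<Longrightarrow> h e \<in> {C, reverse_digraph C}"
    and "\<And>i. i < l \<Longrightarrow>
      r i = card {(u, v) \<in> parcs (cycle_part (D i)). h ((i, u), (i, v)) = reverse_digraph C}"
    and "\<And>i. i < l \<Longrightarrow>
      k i = card (generate (integer_mod_group n)
                   {(int (length (ts i)) - 2 * int (r i)) mod int n})"
  shows "digraph_iso
    (und (digraph_product (disjoint_sum {..<l} D) V h))
    (disjoint_sum {..<l} (\<lambda>i. copies (n div k i) (unicyclic (list_power (ts i) (k i)))))"
proof -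
  let ?P = "und (digraph_product (disjoint_sum {..<l} D) V h)"
  let ?hi = "\<lambda>i (u, v). h ((i, u), (i, v))"
  let ?H = "\<lambda>i. copies (n div k i) (unicyclic (list_power (ts i) (k i)))"
  have ts: "cycle_of_trees (ts i)" if "i < l" for i
    using assms(6,7) that by unfold_locales blast+
  have "\<exists>F. pair_iso F (und (digraph_product (D i) V (?hi i))) (?H i) \<and> k i \<noteq> 0"
    if i: "i < l" for i
  proof -
    have "h ((i, u), (i, v)) \<in> {C, reverse_digraph C}" if "(u, v) \<in> parcs (D i)" for u v
      by (rule assms(11)) (use i that in simp)
    then have hi: "?hi i e \<in> {C, reverse_digraph C}" if "e \<in> parcs (D i)" for e
      using that by (cases e) simp
    have ri: "r i = card {e \<in> parcs (cycle_part (D i)). ?hi i e = reverse_digraph C}"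
      unfolding assms(12)[OF i] by (rule arg_cong[where f = card]) auto
    have "n \<noteq> 0" "card (pverts C) = n" using assms(1,2,4) by auto
    from unicyclic_product_iso[OF this assms(3) ts[OF i] assms(8,9,10)[OF i] hi ri assms(13)[OF i]]
    show ?thesis unfolding assms(4) by metis
  qed
  then obtain F where F: "\<And>i. i < l \<Longrightarrow> pair_iso (F i) (und (digraph_product (D i) V (?hi i))) (?H i)"
    and k: "\<And>i. i < l \<Longrightarrow> k i \<noteq> 0"
    by metis
  have prod_verts: "pverts (und (digraph_product E V h')) = pverts E \<times> V"
    for E :: "'x pair_pre_digraph" and h'
    by (simp add: digraph_product_def)
  have F_in: "F i (u, x) \<in> pverts (?H i)" if "i < l" "u \<in> pverts (D i)" "x \<in> V" for i u x
    using pair_iso_in_verts[OF F[OF that(1)], of "(u, x)"] that unfolding prod_verts by blast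
  have F_bij: "bij_betw (F i) (pverts (D i) \<times> V) (pverts (?H i))" if "i < l" for i
    using pair_iso_bij[OF F[OF that]] by (simp only: prod_verts)
  \<comment> \<open>The product distributes over the disjoint sum once ((i, u), x) is regrouped as
    (i, (u, x)); \<open>F i\<close> then acts on the i-th part.\<close>
  let ?F = "\<lambda>((i, u), x). (i, F i (u, x))"
  have "pair_iso ?F ?P (disjoint_sum {..<l} ?H)"
  proof (rule pair_isoI)
    show "bij_betw ?F (pverts ?P) (pverts (disjoint_sum {..<l} ?H))"
    proof (rule bij_betw_imageI)
      show "inj_on ?F (pverts ?P)"
        unfolding prod_verts using F_bij
        by (auto simp: inj_on_def bij_betw_def disjoint_sum_def)
      have "y \<in> ?F ` pverts ?P" if y: "y \<in> pverts (disjoint_sum {..<l} ?H)" for y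
      proof -
        obtain i q where iq: "y = (i, q)" "i < l" "q \<in> pverts (?H i)"
          using y by (auto simp: disjoint_sum_def)
        then have "q \<in> F i ` (pverts (D i) \<times> V)" using F_bij by (simp add: bij_betw_def)
        then obtain u x where ux: "q = F i (u, x)" "u \<in> pverts (D i)" "x \<in> V" by auto
        have "((i, u), x) \<in> pverts ?P" unfolding prod_verts using iq ux by simp
        then show ?thesis using iq ux by (intro image_eqI[where x = "((i, u), x)"]) auto
      qed
      moreover have "?F z \<in> pverts (disjoint_sum {..<l} ?H)" if "z \<in> pverts ?P" for z
        using that F_in unfolding prod_verts by (auto simp del: prod.simps(1))
      ultimately show "?F ` pverts ?P = pverts (disjoint_sum {..<l} ?H)" by blast
    qed
    fix z z' assume zz: "z \<in> pverts ?P" "z' \<in> pverts ?P"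
    then obtain i u x j v y where z: "z = ((i, u), x)" "z' = ((j, v), y)"
      and V: "i < l" "u \<in> pverts (D i)" "x \<in> V" "j < l" "v \<in> pverts (D j)" "y \<in> V"
      unfolding prod_verts by (cases z; cases z') auto
    \<comment> \<open>For i distinct from j, neither graph has an arc between the two parts.\<close>
    show "(z, z') \<in> parcs ?P \<longleftrightarrow> (?F z, ?F z') \<in> parcs (disjoint_sum {..<l} ?H)"
    proof (cases "i = j")
      case True
      have "(z, z') \<in> parcs ?P \<longleftrightarrow> ((u, x), (v, y)) \<in> parcs (und (digraph_product (D i) V (?hi i)))"
        using V True by (simp add: z in_parcs_und_digraph_product)
      also have "\<dots> \<longleftrightarrow> (F i (u, x), F i (v, y)) \<in> parcs (?H i)"
        using pair_iso_arc_iff[OF F[OF V(1)], of "(u, x)" "(v, y)"] V True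
        by (simp only: prod_verts mem_Sigma_iff simp_thms)
      finally show ?thesis using V True by (simp add: z)
    qed (simp add: z in_parcs_und_digraph_product)
  qed
  \<comment> \<open>The passage from \<open>pair_iso\<close> to \<open>digraph_iso\<close> asks that
    arcs of the product and of the target join vertices; for the target this holds because each
    repeated list is again a cycle of trees.\<close>
  moreover have "parcs ?P \<subseteq> pverts ?P \<times> pverts ?P"
  proof -
    let ?D = "disjoint_sum {..<l} D"
    have "parcs ?D \<subseteq> pverts ?D \<times> pverts ?D"
      using assms(8) oriented_graph_wf by (intro disjoint_sum_wf) auto
    moreover have "parcs C \<subseteq> V \<times> V"
      using strongly_oriented_cycle_wf[OF assms(3)] assms(4) by simp
    then have "parcs (h e) \<subseteq> V \<times> V" if "e \<in> parcs ?D" for e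
      using assms(11)[OF that] by (auto simp: reverse_digraph_def)
    ultimately show ?thesis by (rule digraph_product_wf)
  qed
  moreover have "parcs (disjoint_sum {..<l} ?H) \<subseteq>
      pverts (disjoint_sum {..<l} ?H) \<times> pverts (disjoint_sum {..<l} ?H)"
    unfolding copies_def
    using cycle_of_trees.unicyclic_wf[OF cycle_of_trees_list_power[OF ts k]]
    by (intro disjoint_sum_wf) auto
  ultimately show ?thesis by (rule pair_iso_imp_digraph_iso)
qed

end
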